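(* Let $u_h$ be a solution of the semi-discrete scheme: $u_h\in H^1(0,\overline t;V_h^0)$, $u_h(0,\cdot)=Q_h\psi$ and $(u_{h,t},v_0)+(\Delta_w u_h,\Delta_w v)=(f,v_0)$ for all $v=\{v_0,v_b,v_n\mathbf n_e\}\in V_h^0$. Then there exists a positive constant $C$ (independent of $h$) such that, for $t\in[0,\overline t]$, $$\|u_h(t)\|^2\le C\Big(\|u_h(0)\|^2+\int_0^t\|f(s)\|^2\,ds\Big).$$
   Context: Let $\Omega\subset\mathbb R^d$ ($d=2,3$) be a bounded polygonal/polyhedral domain, $\overline t>0$, $f\in L^2(0,\overline t;L^2(\Omega))$, $\psi\in H_0^2(\Omega)$. $(\cdot,\cdot)$, $\|\cdot\|$ denote the $L^2(\Omega)$ inner product and norm (computed elementwise for piecewise functions); for a weak function $v=\{v_0,v_b,v_n\mathbf n_e\}$, $\|v\|:=\|v_0\|$. $u_{h,t}$ paired with $v_0$ means the time derivative of the interior component of $u_h$. Mesh: $\mathcal T_h$ is a partition of $\Omega$ into polygons/polyhedra $T$ of diameter $h_T$, $h=\max_T h_T$, with edges/faces $\mathcal E_h$, shape regular in the usual weak Galerkin sense with constants independent of $h$: (A1) $|T|\ge \varrho_v h_T^d$, $|e|\ge\varrho_e h_e^{d-1}$; (A2) $h_e\ge\kappa h_T$ for $e\subset\partial T$; (A3) for every $T$ and $e\subset\partial T$ there is a pyramid in $T$ with base $e$, apex $A_e\in T$, height at least $\sigma_e h_T$, the angle between $x_e-A_e$ and the outward normal being strictly acute for all $x_e\in e$; (A4)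 each $T$ has a shape regular circumscribed simplex of diameter at most $\gamma_* h_T$ meeting only a fixed bounded number of other such simplices. For each $e\in\mathcal E_h$ fix one unit normal $\mathbf n_e$; $\mathbf n$ is the outward unit normal of $\partial T$. Spaces: for an integer $k\ge2$, $V_h=\{v=\{v_0,v_b,v_n\mathbf n_e\}: v_0|_T\in P_k(T),\ v_b|_e\in P_k(e),\ v_n|_e\in P_{k-1}(e)\}$ ($v_b,v_n$ single valued on each $e\in\mathcal E_h$), $V_h^0=\{v\in V_h: v_b|_e=0,\ v_n|_e=0 \text{ for } e\subset\partial\Omega\}$. The weak Laplacian $\Delta_w v|_T\in P_r(T)$ is defined by $(\Delta_w v,\varphi)_T=(v_0,\Delta\varphi)_T-\langle v_b,\nabla\varphi\cdot\mathbf n\rangle_{\partial T}+\langle v_n\mathbf n_e\cdot\mathbf n,\varphi\rangle_{\partial T}$ for all $\varphi\in P_r(T)$. The degree $r$ is taken large enough (depending on $k$ and the mesh regularity) that with $|||v|||^2=(\Delta_w v,\Delta_w v)$ and $\|v\|_{2,h}^2=\sum_T(\|\Delta v_0\|_T^2+h_T^{-3}\|v_0-v_b\|_{\partial T}^2+h_T^{-1}\|(\nabla v_0-v_n\mathbf n_e)\cdot\mathbf n\|_{\partial T}^2)$ one has $C_1\|v\|_{2,h}\le|||v|||\le C_2\|v\|_{2,h}$ for $v\in V_h$, with $C_1,C_2>0$ independent of $h$. Projections: $Q_0,Q_b,Q_n$ are the $L^2$ projections onto $P_k(T)$, $P_k(e)$, $P_{k-1}(e)$; $Q_hu=\{Q_0u,Q_bu,Q_n(\nabla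 u\cdot\mathbf n_e)\mathbf n_e\}$. *)

theory Defs
  imports "HOL-Analysis.Analysis"
begin

section \<open>Derivatives, test functions, square integrable functions\<close>

definition pderiv_dir :: "'a::euclidean_space \<Rightarrow> ('a \<Rightarrow> real) \<Rightarrow> 'a \<Rightarrow> real" where
  "pderiv_dir b g x = frechet_derivative g (at x) b"

definition grad :: "('a::euclidean_space \<Rightarrow> real) \<Rightarrow> 'a \<Rightarrow> 'a" where
  "grad g x = (\<Sum>b\<in>Basis. pderiv_dir b g x *\<^sub>R b)"

definition laplacian :: "('a::euclidean_space \<Rightarrow> real) \<Rightarrow> 'a \<Rightarrow> real" where
  "laplacian g x = (\<Sum>b\<in>Basis. pderiv_dir b (pderiv_dir b g) x)"

definition smooth :: "('a::euclidean_space \<Rightarrow> real) \<Rightarrow> bool" where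
  "smooth g \<longleftrightarrow> (\<forall>bs. set bs \<subseteq> Basis \<longrightarrow> (\<forall>x. foldr pderiv_dir bs g differentiable (at x)))"

definition test_functions :: "'a::euclidean_space set \<Rightarrow> ('a \<Rightarrow> real) set" where
  "test_functions S = {\<phi>. smooth \<phi> \<and> compact (closure {x. \<phi> x \<noteq> 0}) \<and> closure {x. \<phi> x \<noteq> 0} \<subseteq> S}"

text \<open>
  The elements of the following set represent the classes of $L^2$; functions that agree
  almost everywhere are not identified.
\<close>
definition L2 :: "'a measure \<Rightarrow> ('a \<Rightarrow> real) set" where
  "L2 m = {g. g \<in> borel_measurable m \<and> integrable m (\<lambda>x. (g x)\<^sup>2)}"

definition L2_norm :: "'a measure \<Rightarrow> ('a \<Rightarrow> real) \<Rightarrow> real" where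
  "L2_norm m g = sqrt (LINT x|m. (g x)\<^sup>2)"

text \<open>$L^2$ projection of \<open>g\<close> onto the finite-dimensional space \<open>P\<close>.\<close>
definition L2_proj :: "'a measure \<Rightarrow> ('a \<Rightarrow> real) set \<Rightarrow> ('a \<Rightarrow> real) \<Rightarrow> 'a \<Rightarrow> real" where
  "L2_proj m P g = (THE q. q \<in> P \<and> (\<forall>p\<in>P. (LINT x|m. q x * p x) = (LINT x|m. g x * p x)))"


section \<open>Polygons and polyhedra, surface measure\<close>

text \<open>
  A closed, possibly non-convex flat cell of dimension \<open>m\<close>: with \<open>m = d\<close> a polygon (polyhedron),
  with \<open>m = d - 1\<close> an edge (a face).
\<close>
definition cell :: "int \<Rightarrow> 'a::euclidean_space set \<Rightarrow> bool" where
  "cell m S \<longleftrightarrow> aff_dim S = m \<and>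
     (\<exists>\<P>. finite \<P> \<and> (\<forall>P\<in>\<P>. polytope P \<and> aff_dim P = m) \<and> S = \<Union>\<P>) \<and>
     connected (rel_interior S)"

definition polyhedral_domain :: "'a::euclidean_space set \<Rightarrow> bool" where
  "polyhedral_domain \<Omega> \<longleftrightarrow> (\<exists>S. cell (int DIM('a)) S \<and> \<Omega> = interior S)"

text \<open>
  The $(d-1)$-dimensional measure on a set \<open>e\<close> spanning a hyperplane \<open>A\<close>: the Lebesgue measure
  on the prism of height one over \<open>e\<close> (one half on each side of \<open>A\<close>), pushed forward under
  the orthogonal projection onto \<open>A\<close>. As a measure on the whole space it is concentrated on \<open>e\<close>.
\<close>
definition surf :: "'a::euclidean_space set \<Rightarrow> 'a measure" where
  "surf e = (let A = affine hull e in
     distr (lebesgue_on {y. closest_point A y \<in> e \<and> dist y (closest_point A y) \<le> 1 / 2})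
           borel (closest_point A))"


section \<open>Sobolev spaces and traces\<close>

definition weak_pderiv :: "'a::euclidean_space set \<Rightarrow> 'a \<Rightarrow> ('a \<Rightarrow> real) \<Rightarrow> ('a \<Rightarrow> real) \<Rightarrow> bool" where
  "weak_pderiv \<Omega> b g g' \<longleftrightarrow> g' \<in> L2 (lebesgue_on \<Omega>) \<and>
     (\<forall>\<phi>\<in>test_functions \<Omega>.
        (LINT x|lebesgue_on \<Omega>. g x * pderiv_dir b \<phi> x) = - (LINT x|lebesgue_on \<Omega>. g' x * \<phi> x))"

definition weak_grad :: "'a::euclidean_space set \<Rightarrow> ('a \<Rightarrow> real) \<Rightarrow> 'a \<Rightarrow> 'a" where
  "weak_grad \<Omega> g = (SOME G. \<forall>b\<in>Basis. weak_pderiv \<Omega> b g (\<lambda>x. G x \<bullet> b))"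

text \<open>Convergence of smooth functions \<open>\<phi> n\<close> to \<open>g\<close> in $H^1(\Omega)$ and in $H^2(\Omega)$.\<close>
definition H1_lim :: "'a::euclidean_space set \<Rightarrow> (nat \<Rightarrow> 'a \<Rightarrow> real) \<Rightarrow> ('a \<Rightarrow> real) \<Rightarrow> bool" where
  "H1_lim \<Omega> \<phi> g \<longleftrightarrow> g \<in> L2 (lebesgue_on \<Omega>) \<and>
     (\<lambda>n. L2_norm (lebesgue_on \<Omega>) (\<lambda>x. \<phi> n x - g x)) \<longlonglongrightarrow> 0 \<and>
     (\<forall>b\<in>Basis. \<exists>g'. weak_pderiv \<Omega> b g g' \<and>
        (\<lambda>n. L2_norm (lebesgue_on \<Omega>) (\<lambda>x. pderiv_dir b (\<phi> n) x - g' x)) \<longlonglongrightarrow> 0)"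

definition H2_lim :: "'a::euclidean_space set \<Rightarrow> (nat \<Rightarrow> 'a \<Rightarrow> real) \<Rightarrow> ('a \<Rightarrow> real) \<Rightarrow> bool" where
  "H2_lim \<Omega> \<phi> g \<longleftrightarrow> H1_lim \<Omega> \<phi> g \<and>
     (\<forall>b\<in>Basis. \<exists>g'. weak_pderiv \<Omega> b g g' \<and> H1_lim \<Omega> (\<lambda>n. pderiv_dir b (\<phi> n)) g')"

definition H02 :: "'a::euclidean_space set \<Rightarrow> ('a \<Rightarrow> real) set" where
  "H02 \<Omega> = {g. \<exists>\<phi>. (\<forall>n. \<phi> n \<in> test_functions \<Omega>) \<and> H2_lim \<Omega> \<phi> g}"

text \<open>
  Trace on \<open>e \<subseteq> closure \<Omega>\<close> of a function in $H_0^1(\Omega)$: the continuous extension of the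
  restriction map from the dense subspace of test functions, with values in $L^2(e)$.
  It is determined up to a set of surface measure zero.
\<close>
definition face_trace :: "'a::euclidean_space set \<Rightarrow> 'a set \<Rightarrow> ('a \<Rightarrow> real) \<Rightarrow> 'a \<Rightarrow> real" where
  "face_trace \<Omega> e g = (SOME \<gamma>. \<gamma> \<in> L2 (surf e) \<and>
     (\<exists>\<phi>. (\<forall>n. \<phi> n \<in> test_functions \<Omega>) \<and> H1_lim \<Omega> \<phi> g \<and>
          (\<lambda>n. L2_norm (surf e) (\<lambda>x. \<phi> n x - \<gamma> x)) \<longlonglongrightarrow> 0))"


section \<open>Meshes\<close>

text \<open>Elements $T$ and edges/faces $e$ are closed sets; \<open>nrm e\<close> is the fixed normal $n_e$.\<close>
record 'a mesh =
  elems :: "'a set set"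
  faces :: "'a set set"
  nrm :: "'a set \<Rightarrow> 'a"

definition faces_of :: "'a::euclidean_space mesh \<Rightarrow> 'a set \<Rightarrow> 'a set set" where
  "faces_of M T = {e \<in> faces M. e \<subseteq> frontier T}"

definition unit_normal :: "'a::euclidean_space set \<Rightarrow> 'a \<Rightarrow> bool" where
  "unit_normal e \<nu> \<longleftrightarrow> norm \<nu> = 1 \<and> (\<forall>x\<in>e. \<forall>y\<in>e. \<nu> \<bullet> (x - y) = 0)"

definition is_outer_normal :: "'a::euclidean_space set \<Rightarrow> 'a set \<Rightarrow> 'a \<Rightarrow> bool" where
  "is_outer_normal T e \<nu> \<longleftrightarrow> unit_normal e \<nu> \<and>
     (\<forall>x\<in>rel_interior e. \<exists>\<delta>>0. \<forall>s. 0 < s \<and> s < \<delta> \<longrightarrow>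
        x - s *\<^sub>R \<nu> \<in> interior T \<and> x + s *\<^sub>R \<nu> \<notin> T)"

definition outer_normal :: "'a::euclidean_space set \<Rightarrow> 'a set \<Rightarrow> 'a" where
  "outer_normal T e = (THE \<nu>. is_outer_normal T e \<nu>)"

text \<open>
  Hanging nodes are admitted: a side of an element may be composed of several members of
  \<open>faces M\<close>, provided that every boundary is exactly covered.
\<close>
definition partition_of :: "'a::euclidean_space set \<Rightarrow> 'a mesh \<Rightarrow> bool" where
  "partition_of \<Omega> M \<longleftrightarrow>
     finite (elems M) \<and> finite (faces M) \<and>
     (\<forall>T\<in>elems M. cell (int DIM('a)) T) \<and>
     closure \<Omega> = \<Union>(elems M) \<and>
     (\<forall>T\<in>elems M. \<forall>T'\<in>elems M. T \<noteq> T' \<longrightarrow> interior T \<inter> interior T' = {}) \<and>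
     (\<forall>e\<in>faces M. cell (int DIM('a) - 1) e \<and> unit_normal e (nrm M e)) \<and>
     (\<forall>e\<in>faces M. \<forall>e'\<in>faces M. e \<noteq> e' \<longrightarrow> rel_interior e \<inter> rel_interior e' = {}) \<and>
     (\<forall>e\<in>faces M. \<exists>T\<in>elems M. e \<in> faces_of M T) \<and>
     (\<forall>T\<in>elems M. frontier T = \<Union>(faces_of M T)) \<and>
     (\<forall>T\<in>elems M. \<forall>e\<in>faces_of M T. \<exists>\<nu>. is_outer_normal T e \<nu>)"

text \<open>
  The last clause bounds, for each \<open>T\<close>, the number of the other elements whose simplex meets
  that of \<open>T\<close>; the simplices are shape regular in that each contains a ball of radius
  proportional to its diameter.
\<close>
definition shape_regular ::
  "real \<Rightarrow> real \<Rightarrow> real \<Rightarrow> real \<Rightarrow> real \<Rightarrow> real \<Rightarrow> nat \<Rightarrow> 'a::euclidean_space mesh \<Rightarrow> bool" where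
  "shape_regular \<rho>v \<rho>e \<kappa> \<sigma> \<gamma> \<rho>s N M \<longleftrightarrow>
     (\<forall>T\<in>elems M. measure lebesgue T \<ge> \<rho>v * diameter T ^ DIM('a)) \<and>
     (\<forall>e\<in>faces M. measure (surf e) e \<ge> \<rho>e * diameter e ^ (DIM('a) - 1)) \<and>
     (\<forall>T\<in>elems M. \<forall>e\<in>faces_of M T. diameter e \<ge> \<kappa> * diameter T) \<and>
     (\<forall>T\<in>elems M. \<forall>e\<in>faces_of M T. \<exists>A\<in>T.
        (\<Union>x\<in>e. closed_segment A x) \<subseteq> T \<and>
        infdist A (affine hull e) \<ge> \<sigma> * diameter T \<and>
        (\<forall>x\<in>e. (x - A) \<bullet> outer_normal T e > 0)) \<and>
     (\<exists>S. \<forall>T\<in>elems M.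
        (int DIM('a)) simplex (S T) \<and> T \<subseteq> S T \<and>
        (\<exists>c. cball c (\<rho>s * diameter (S T)) \<subseteq> S T) \<and>
        diameter (S T) \<le> \<gamma> * diameter T \<and>
        card {T' \<in> elems M. T' \<noteq> T \<and> S T \<inter> S T' \<noteq> {}} \<le> N)"


section \<open>Weak functions and the weak Laplacian\<close>

definition polys :: "nat \<Rightarrow> ((real ^ 'd) \<Rightarrow> real) set" where
  "polys k = {p. \<exists>c :: ('d \<Rightarrow> nat) \<Rightarrow> real.
     p = (\<lambda>x. \<Sum>\<alpha> | (\<Sum>i\<in>UNIV. \<alpha> i) \<le> k. c \<alpha> * (\<Prod>i\<in>UNIV. (x $ i) ^ \<alpha> i))}"

text \<open>$P_k(e)$: restrictions to \<open>e\<close>, continued by zero so that they are determined by their values on \<open>e\<close>.\<close>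
definition face_polys :: "nat \<Rightarrow> (real ^ 'd) set \<Rightarrow> ((real ^ 'd) \<Rightarrow> real) set" where
  "face_polys k e = (\<lambda>p x. if x \<in> e then p x else 0) ` polys k"

text \<open>
  A weak function is a triple $(v_0, v_b, v_n)$, where \<open>v0 v T\<close> stands for $v_0|_T$ and
  \<open>vb v e\<close>, \<open>vn v e\<close> for $v_b|_e$, $v_n|_e$. Since $T$ has interior points, a polynomial on $T$ is
  identified with its unique extension to the whole space. The components are zero at sets that
  are not elements or faces, so that equality of triples is equality of weak functions.
\<close>
type_synonym 'a weak_fun =
  "('a set \<Rightarrow> 'a \<Rightarrow> real) \<times> ('a set \<Rightarrow> 'a \<Rightarrow> real) \<times> ('a set \<Rightarrow> 'a \<Rightarrow> real)"

abbreviation v0 :: "'a weak_fun \<Rightarrow> 'a set \<Rightarrow> 'a \<Rightarrow> real" where "v0 v \<equiv> fst v"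
abbreviation vb :: "'a weak_fun \<Rightarrow> 'a set \<Rightarrow> 'a \<Rightarrow> real" where "vb v \<equiv> fst (snd v)"
abbreviation vn :: "'a weak_fun \<Rightarrow> 'a set \<Rightarrow> 'a \<Rightarrow> real" where "vn v \<equiv> snd (snd v)"

definition Vh :: "(real ^ 'd) mesh \<Rightarrow> nat \<Rightarrow> (real ^ 'd) weak_fun set" where
  "Vh M k = {v.
     (\<forall>T\<in>elems M. v0 v T \<in> polys k) \<and> (\<forall>T. T \<notin> elems M \<longrightarrow> v0 v T = (\<lambda>_. 0)) \<and>
     (\<forall>e\<in>faces M. vb v e \<in> face_polys k e \<and> vn v e \<in> face_polys (k - 1) e) \<and>
     (\<forall>e. e \<notin> faces M \<longrightarrow> vb v e = (\<lambda>_. 0) \<and> vn v e = (\<lambda>_. 0))}"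

definition Vh0 :: "(real ^ 'd) set \<Rightarrow> (real ^ 'd) mesh \<Rightarrow> nat \<Rightarrow> (real ^ 'd) weak_fun set" where
  "Vh0 \<Omega> M k = {v \<in> Vh M k. \<forall>e\<in>faces M. e \<subseteq> frontier \<Omega> \<longrightarrow> (\<forall>x\<in>e. vb v e x = 0 \<and> vn v e x = 0)}"

definition weak_laplacian ::
  "nat \<Rightarrow> (real ^ 'd) mesh \<Rightarrow> (real ^ 'd) weak_fun \<Rightarrow> (real ^ 'd) set \<Rightarrow> (real ^ 'd) \<Rightarrow> real" where
  "weak_laplacian r M v T = (THE w. w \<in> polys r \<and>
     (\<forall>\<phi>\<in>polys r. (LINT x|lebesgue_on T. w x * \<phi> x) =
        (LINT x|lebesgue_on T. v0 v T x * laplacian \<phi> x)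
        - (\<Sum>e\<in>faces_of M T. LINT x|surf e. vb v e x * (grad \<phi> x \<bullet> outer_normal T e))
        + (\<Sum>e\<in>faces_of M T. LINT x|surf e. vn v e x * (nrm M e \<bullet> outer_normal T e) * \<phi> x)))"

text \<open>The elementwise $L^2$ inner product of piecewise functions.\<close>
definition ip :: "'a::euclidean_space mesh \<Rightarrow> ('a set \<Rightarrow> 'a \<Rightarrow> real) \<Rightarrow> ('a set \<Rightarrow> 'a \<Rightarrow> real) \<Rightarrow> real" where
  "ip M p q = (\<Sum>T\<in>elems M. LINT x|lebesgue_on T. p T x * q T x)"

text \<open>$\|v\| = \|v_0\|$\<close>
definition wf_norm :: "'a::euclidean_space mesh \<Rightarrow> 'a weak_fun \<Rightarrow> real" where
  "wf_norm M v = sqrt (ip M (v0 v) (v0 v))"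

definition triple_norm :: "nat \<Rightarrow> (real ^ 'd) mesh \<Rightarrow> (real ^ 'd) weak_fun \<Rightarrow> real" where
  "triple_norm r M v = sqrt (ip M (weak_laplacian r M v) (weak_laplacian r M v))"

definition norm_2h :: "(real ^ 'd) mesh \<Rightarrow> (real ^ 'd) weak_fun \<Rightarrow> real" where
  "norm_2h M v = sqrt (\<Sum>T\<in>elems M.
     (LINT x|lebesgue_on T. (laplacian (v0 v T) x)\<^sup>2)
     + (\<Sum>e\<in>faces_of M T. LINT x|surf e. (v0 v T x - vb v e x)\<^sup>2) / diameter T ^ 3
     + (\<Sum>e\<in>faces_of M T. LINT x|surf e.
          ((grad (v0 v T) x - vn v e x *\<^sub>R nrm M e) \<bullet> outer_normal T e)\<^sup>2) / diameter T)"

definition Qh :: "(real ^ 'd) set \<Rightarrow> (real ^ 'd) mesh \<Rightarrow> nat \<Rightarrow> ((real ^ 'd) \<Rightarrow> real) \<Rightarrow> (real ^ 'd) weak_fun" where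
  "Qh \<Omega> M k \<psi> =
    ((\<lambda>T. if T \<in> elems M then L2_proj (lebesgue_on T) (polys k) \<psi> else (\<lambda>_. 0)),
     (\<lambda>e. if e \<in> faces M then L2_proj (surf e) (face_polys k e) (face_trace \<Omega> e \<psi>) else (\<lambda>_. 0)),
     (\<lambda>e. if e \<in> faces M
          then L2_proj (surf e) (face_polys (k - 1) e)
                 (face_trace \<Omega> e (\<lambda>x. weak_grad \<Omega> \<psi> x \<bullet> nrm M e))
          else (\<lambda>_. 0)))"


section \<open>Functions of time and the semi-discrete scheme\<close>

text \<open>
  The Bochner space $L^2(0,\bar t;X)$ for a space \<open>X\<close> with norm \<open>\<nu>\<close>: strongly measurable functions
  (almost everywhere limits of simple functions) whose norm is square integrable.
\<close>
definition bochner_L2 :: "real \<Rightarrow> 'v::minus set \<Rightarrow> ('v \<Rightarrow> real) \<Rightarrow> (real \<Rightarrow> 'v) \<Rightarrow> bool" where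
  "bochner_L2 tbar X \<nu> g \<longleftrightarrow>
     (AE t in lebesgue_on {0..tbar}. g t \<in> X) \<and>
     (\<exists>s. (\<forall>n. finite (s n ` {0..tbar}) \<and> s n ` {0..tbar} \<subseteq> X \<and>
               (\<forall>y. {t \<in> {0..tbar}. s n t = y} \<in> sets lebesgue)) \<and>
          (AE t in lebesgue_on {0..tbar}. (\<lambda>n. \<nu> (s n t - g t)) \<longlonglongrightarrow> 0)) \<and>
     integrable (lebesgue_on {0..tbar}) (\<lambda>t. (\<nu> (g t))\<^sup>2)"

text \<open>
  A norm on the finite-dimensional space $V_h$ (all norms on it are equivalent). It is chosen to
  make evaluation at points continuous, so that equations between $V_h$-valued Bochner integrals
  can be stated pointwise.
\<close>
definition Vh_norm :: "'a mesh \<Rightarrow> 'a weak_fun \<Rightarrow> real" where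
  "Vh_norm M v = (\<Sum>T\<in>elems M. SUP x\<in>T. \<bar>v0 v T x\<bar>)
     + (\<Sum>e\<in>faces M. SUP x\<in>e. \<bar>vb v e x\<bar>) + (\<Sum>e\<in>faces M. SUP x\<in>e. \<bar>vn v e x\<bar>)"

text \<open>The identity $\int_0^{\bar t} u\,\phi' = - \int_0^{\bar t} u'\phi$ in $V_h$, for all test functions $\phi$.\<close>
definition weak_time_deriv ::
  "real \<Rightarrow> 'a mesh \<Rightarrow> (real \<Rightarrow> 'a weak_fun) \<Rightarrow> (real \<Rightarrow> 'a weak_fun) \<Rightarrow> bool" where
  "weak_time_deriv tbar M u u' \<longleftrightarrow> (\<forall>\<phi>\<in>test_functions {0<..<tbar}.
     (\<forall>T\<in>elems M. \<forall>x\<in>T.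
        (LINT t|lebesgue_on {0..tbar}. v0 (u t) T x * deriv \<phi> t) =
        - (LINT t|lebesgue_on {0..tbar}. v0 (u' t) T x * \<phi> t)) \<and>
     (\<forall>e\<in>faces M. \<forall>x\<in>e.
        (LINT t|lebesgue_on {0..tbar}. vb (u t) e x * deriv \<phi> t) =
        - (LINT t|lebesgue_on {0..tbar}. vb (u' t) e x * \<phi> t) \<and>
        (LINT t|lebesgue_on {0..tbar}. vn (u t) e x * deriv \<phi> t) =
        - (LINT t|lebesgue_on {0..tbar}. vn (u' t) e x * \<phi> t)))"

text \<open>
  \<open>u\<close> belongs to $H^1(0,\bar t;V_h^0)$ and has the weak derivative \<open>u'\<close>. As values at single times
  occur in the scheme, \<open>u\<close> is the continuous representative of its class.
\<close>
definition H1_time ::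
  "real \<Rightarrow> (real ^ 'd) set \<Rightarrow> (real ^ 'd) mesh \<Rightarrow> nat \<Rightarrow>
   (real \<Rightarrow> (real ^ 'd) weak_fun) \<Rightarrow> (real \<Rightarrow> (real ^ 'd) weak_fun) \<Rightarrow> bool" where
  "H1_time tbar \<Omega> M k u u' \<longleftrightarrow>
     bochner_L2 tbar (Vh0 \<Omega> M k) (Vh_norm M) u \<and>
     bochner_L2 tbar (Vh0 \<Omega> M k) (Vh_norm M) u' \<and>
     weak_time_deriv tbar M u u' \<and>
     (\<forall>t\<in>{0..tbar}. u t \<in> Vh0 \<Omega> M k \<and>
        ((\<lambda>s. Vh_norm M (u s - u t)) \<longlongrightarrow> 0) (at t within {0..tbar}))"

definition semidiscrete_solution ::
  "real \<Rightarrow> (real ^ 'd) set \<Rightarrow> (real ^ 'd) mesh \<Rightarrow> nat \<Rightarrow> nat \<Rightarrow>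
   (real \<Rightarrow> (real ^ 'd) \<Rightarrow> real) \<Rightarrow> ((real ^ 'd) \<Rightarrow> real) \<Rightarrow> (real \<Rightarrow> (real ^ 'd) weak_fun) \<Rightarrow> bool" where
  "semidiscrete_solution tbar \<Omega> M k r f \<psi> u \<longleftrightarrow>
     (\<exists>u'. H1_time tbar \<Omega> M k u u' \<and>
        u 0 = Qh \<Omega> M k \<psi> \<and>
        (AE t in lebesgue_on {0..tbar}. \<forall>v\<in>Vh0 \<Omega> M k.
           ip M (v0 (u' t)) (v0 v) + ip M (weak_laplacian r M (u t)) (weak_laplacian r M v)
           = ip M (\<lambda>T. f t) (v0 v)))"

end

theory Submission
  imports Defs
begin

text \<open>
  The estimate is the energy estimate obtained by testing the scheme with \<open>v = u_h(s)\<close>. Since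
  \<open>(\<Delta>_w u_h, \<Delta>_w u_h) \<ge> 0\<close>, for almost every \<open>s\<close>
  \[ \frac{d}{ds} \|u_h(s)\|^2 = 2 (u_{h,t}, u_h) \le 2 (f, u_h)
     \le 2 \bar t \, \|f(s)\|^2 + \frac{1}{2 \bar t} \|u_h(s)\|^2 . \]
  If this is integrated up to a point at which the continuous function \<open>\<parallel>u_h\<parallel>\<^sup>2\<close> attains its maximum
  on \<open>{0..t}\<close>, the last term contributes at most half of that maximum and can be absorbed on the
  left. This yields the estimate with $C = 2 + 4 \bar t$, uniformly over all meshes.

  The work lies in the first equality, because \<open>u_h\<close> has only a weak derivative in time, tested
  pointwise in space. Choosing smooth approximations of the indicator function of an
  interval as test functions shows that each point value of the interior component of \<open>u_h\<close> is an
  indefinite integral of the corresponding point value of the derivative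
  (\<open>weak_derivative_imp_integral\<close>), and indefinite integrals obey the product rule
  (\<open>integral_product_rule\<close>). To pass from point values to the $L^2$ inner product without
  interchanging integrals over space and time, the inner product of polynomials of bounded degree
  on an element is written as a bilinear form in their values at finitely many points
  (\<open>polys_inner_product_point_values\<close>). Together these facts give \<open>energy_identity\<close>.

  The source term is estimated element by element; that the elementwise integrals add up
  to the integral over \<open>\<Omega>\<close> (\<open>sum_integral_elements\<close>) rests on the fact that the boundaries of the
  elements are null sets.
\<close>

section \<open>Smooth approximations of indicator functions\<close>

text \<open>
  With the extra parameter \<open>n\<close> the derivative of \<open>flat n\<close> is again a linear combination of such
  functions, so that no polynomials in \<open>1 / x\<close> are needed to describe the higher derivatives of
  \<open>exp (- 1 / x)\<close>.
\<close>
definition flat :: "nat \<Rightarrow> real \<Rightarrow> real" where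
  "flat n x = (if x > 0 then exp (- 1 / x) / x ^ n else 0)"

lemma flat_nonneg: "0 \<le> flat n x"
  by (simp add: flat_def)

lemma flat_pos: "0 < x \<Longrightarrow> 0 < flat n x"
  by (simp add: flat_def)

lemma flat_eq_0: "x \<le> 0 \<Longrightarrow> flat n x = 0"
  by (simp add: flat_def)

text \<open>
  In the variable \<open>y = 1 / x\<close> this says that \<open>exp y\<close> grows faster than \<open>y ^ n\<close>. It also yields
  differentiability at \<open>0\<close>, where the difference quotient of \<open>flat n\<close> is \<open>flat (n + 1)\<close>.
\<close>
lemma flat_tendsto_0: "(flat n \<longlongrightarrow> 0) (at 0)"
proof (rule filterlim_split_at_real)
  show "(flat n \<longlongrightarrow> 0) (at_left 0)"
  proof (rule tendsto_eventually)
    show "\<forall>\<^sub>F x in at_left 0. flat n x = 0"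
      by (auto simp: eventually_at_filter flat_eq_0)
  qed
  have "((\<lambda>x. (inverse x) ^ n / exp (inverse x)) \<longlongrightarrow> (0::real)) (at_right 0)"
    by (rule filterlim_compose[OF tendsto_power_div_exp_0 filterlim_inverse_at_top_right])
  moreover have "\<forall>\<^sub>F x in at_right (0::real). (inverse x) ^ n / exp (inverse x) = flat n x"
    by (auto simp: eventually_at_filter flat_def field_simps exp_minus)
  ultimately show "(flat n \<longlongrightarrow> 0) (at_right 0)"
    by (rule Lim_transform_eventually)
qed

lemma flat_has_derivative:
  "(flat n has_real_derivative flat (n + 2) x - real n * flat (n + 1) x) (at x)"
proof -
  consider "x < 0" | "x = 0" | "x > 0" by linarith
  then show ?thesis
  proof cases
    case 1
    have "(flat n has_real_derivative 0) (at x)"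
      by (rule DERIV_cong_ev[THEN iffD1, OF refl _ refl DERIV_const[of 0]])
        (use 1 in \<open>auto simp: flat_eq_0 eventually_nhds intro!: exI[of _ "{..<0}"]\<close>)
    then show ?thesis using 1 by (simp add: flat_eq_0)
  next
    case 2
    have "(\<lambda>h. (flat n (0 + h) - flat n 0) / h) = (\<lambda>h. flat (n + 1) h)"
      by (auto simp: flat_def)
    then have "(flat n has_real_derivative 0) (at 0)"
      using flat_tendsto_0[of "n + 1"] by (simp add: DERIV_def)
    then show ?thesis using 2 by (simp add: flat_eq_0)
  next
    case 3
    have "((\<lambda>x. exp (- 1 / x) / x ^ n) has_real_derivative
        exp (- 1 / x) / x ^ (n + 2) - real n * (exp (- 1 / x) / x ^ (n + 1))) (at x)"
    proof -
      have "n = 0 \<or> x ^ n = x * x ^ (n - Suc 0)" by (cases n) auto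
      then show ?thesis
        using 3 by (auto intro!: derivative_eq_intros simp: field_simps power2_eq_square)
    qed
    moreover have "\<forall>\<^sub>F y in nhds x. exp (- 1 / y) / y ^ n = flat n y"
      using eventually_nhds_in_open[of "{0<..}" x] 3 by (auto simp: flat_def elim: eventually_mono)
    ultimately have "(flat n has_real_derivative
        exp (- 1 / x) / x ^ (n + 2) - real n * (exp (- 1 / x) / x ^ (n + 1))) (at x)"
      by (subst (asm) DERIV_cong_ev[OF refl _ refl])
    then show ?thesis using 3 by (simp add: flat_def)
  qed
qed

text \<open>
  An algebra of functions that contains the required bump functions and whose generators and
  operations preserve it under differentiation; smoothness then follows by induction on the
  number of derivatives.
\<close>
inductive_set smooth_funs :: "(real \<Rightarrow> real) set" where
  flat: "(\<lambda>x. flat n (a * x + b)) \<in> smooth_funs"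
| const: "(\<lambda>x. c) \<in> smooth_funs"
| add: "g \<in> smooth_funs \<Longrightarrow> h \<in> smooth_funs \<Longrightarrow> (\<lambda>x. g x + h x) \<in> smooth_funs"
| mult: "g \<in> smooth_funs \<Longrightarrow> h \<in> smooth_funs \<Longrightarrow> (\<lambda>x. g x * h x) \<in> smooth_funs"
| inverse: "g \<in> smooth_funs \<Longrightarrow> (\<And>x. g x \<noteq> 0) \<Longrightarrow> (\<lambda>x. inverse (g x)) \<in> smooth_funs"

lemma smooth_funs_has_derivative:
  assumes "g \<in> smooth_funs"
  shows "\<exists>g'\<in>smooth_funs. \<forall>x. (g has_real_derivative g' x) (at x)"
  using assms
proof induction
  case (flat n a b)
  let ?D = "\<lambda>x. a * flat (n + 2) (a * x + b) + (- real n * a) * flat (n + 1) (a * x + b)"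
  have "?D \<in> smooth_funs"
    by (intro smooth_funs.intros)
  moreover have "((\<lambda>x. flat n (a * x + b)) has_real_derivative ?D x) (at x)" for x
    by (rule DERIV_cong[OF DERIV_chain2[OF flat_has_derivative]])
      (auto intro!: derivative_eq_intros simp: algebra_simps)
  ultimately show ?case by (intro bexI[of _ ?D]) auto
next
  case (const c)
  show ?case by (rule bexI[of _ "\<lambda>x. 0"]) (auto intro: smooth_funs.const[of 0])
next
  case (add g h)
  then obtain g' h' where gh: "g' \<in> smooth_funs" "h' \<in> smooth_funs"
    "\<And>x. (g has_real_derivative g' x) (at x)" "\<And>x. (h has_real_derivative h' x) (at x)" by blast
  show ?case
    by (rule bexI[OF _ smooth_funs.add[OF gh(1,2)]]) (intro allI DERIV_add gh(3,4))
next
  case (mult g h)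
  then obtain g' h' where gh: "g' \<in> smooth_funs" "h' \<in> smooth_funs"
    "\<And>x. (g has_real_derivative g' x) (at x)" "\<And>x. (h has_real_derivative h' x) (at x)" by blast
  show ?case
    by (rule bexI[OF _ smooth_funs.add[OF smooth_funs.mult[OF gh(1) mult.hyps(2)]
          smooth_funs.mult[OF gh(2) mult.hyps(1)]]]) (intro allI DERIV_mult gh(3,4))
next
  case (inverse g)
  then obtain g' where g': "g' \<in> smooth_funs" "\<And>x. (g has_real_derivative g' x) (at x)" by blast
  let ?D = "\<lambda>x. (- 1) * (inverse (g x) * g' x * inverse (g x))"
  note inv = smooth_funs.inverse[OF inverse.hyps(1,2)]
  have "?D \<in> smooth_funs"
    by (rule smooth_funs.mult[OF smooth_funs.const smooth_funs.mult[OF smooth_funs.mult[OF inv g'(1)] inv]])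
  moreover have "\<forall>x. ((\<lambda>x. inverse (g x)) has_real_derivative ?D x) (at x)"
    using DERIV_inverse'[OF g'(2) inverse.hyps(2)] by simp
  ultimately show ?case by (intro bexI[of _ ?D])
qed

lemma smooth_funs_imp_smooth:
  assumes "g \<in> smooth_funs"
  shows "smooth g"
proof -
  have "foldr pderiv_dir bs g \<in> smooth_funs" if "set bs \<subseteq> Basis" for bs
    using that
  proof (induction bs)
    case Nil
    then show ?case using assms by simp
  next
    case (Cons b bs)
    let ?g = "foldr pderiv_dir bs g"
    obtain g' where g': "g' \<in> smooth_funs" "\<And>x. (?g has_real_derivative g' x) (at x)"
      using Cons smooth_funs_has_derivative[of ?g] by auto
    have "b = 1" using Cons.prems by simp
    then have "pderiv_dir b ?g x = g' x" for x
      using g'(2)[of x] by (simp add: pderiv_dir_def frechet_derivative_at[symmetric]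
          has_field_derivative_def)
    then have "pderiv_dir b ?g = g'" by blast
    then show ?case using g'(1) by simp
  qed
  then have "foldr pderiv_dir bs g differentiable (at x)" if "set bs \<subseteq> Basis" for bs x
    using smooth_funs_has_derivative[OF \<open>set bs \<subseteq> Basis \<Longrightarrow> foldr pderiv_dir bs g \<in> smooth_funs\<close>[OF that]]
    by (meson has_field_derivative_imp_has_derivative differentiableI)
  then show ?thesis by (simp add: smooth_def)
qed

text \<open>
  A smooth transition from \<open>0\<close> on the left of \<open>0\<close> to \<open>1\<close> on the right of \<open>1\<close>.
\<close>
definition step :: "real \<Rightarrow> real" where
  "step x = flat 0 x / (flat 0 x + flat 0 (1 - x))"

definition step_deriv :: "real \<Rightarrow> real" where
  "step_deriv x = (flat 2 x * flat 0 (1 - x) + flat 0 x * flat 2 (1 - x))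
     / (flat 0 x + flat 0 (1 - x))\<^sup>2"

lemma step_denom_pos: "0 < flat 0 x + flat 0 (1 - x)"
proof (cases "0 < x")
  case True
  then show ?thesis using flat_pos[of x 0] flat_nonneg[of 0 "1 - x"] by linarith
next
  case False
  then show ?thesis using flat_pos[of "1 - x" 0] flat_nonneg[of 0 x] by linarith
qed

lemma step_bounds: "0 \<le> step x" "step x \<le> 1"
  using step_denom_pos[of x] flat_nonneg[of 0 x] flat_nonneg[of 0 "1 - x"]
  by (auto simp: step_def divide_simps)

lemma step_eq_0: "x \<le> 0 \<Longrightarrow> step x = 0"
  by (simp add: step_def flat_eq_0)

lemma step_eq_1: "1 \<le> x \<Longrightarrow> step x = 1"
  using flat_pos[of x 0] by (simp add: step_def flat_eq_0)

lemma step_deriv_nonneg: "0 \<le> step_deriv x"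
  by (simp add: step_deriv_def flat_nonneg)

lemma step_deriv_eq_0: "x \<notin> {0..1} \<Longrightarrow> step_deriv x = 0"
  by (auto simp: step_deriv_def flat_eq_0)

lemma step_has_derivative: "(step has_real_derivative step_deriv x) (at x)"
proof -
  have f: "(flat 0 has_real_derivative flat 2 y) (at y)" for y
    using flat_has_derivative[of 0 y] by (simp add: numeral_2_eq_2)
  have g: "((\<lambda>x. flat 0 (1 - x)) has_real_derivative - flat 2 (1 - x)) (at x)"
    by (rule DERIV_cong[OF DERIV_chain2[OF f]]) (auto intro!: derivative_eq_intros)
  have "flat 0 x + flat 0 (1 - x) \<noteq> 0"
    using step_denom_pos[of x] by simp
  from DERIV_divide[OF f[of x] DERIV_add[OF f[of x] g] this]
  have "(step has_real_derivative
      (flat 2 x * (flat 0 x + flat 0 (1 - x)) - flat 0 x * (flat 2 x + - flat 2 (1 - x))) /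
      ((flat 0 x + flat 0 (1 - x)) * (flat 0 x + flat 0 (1 - x)))) (at x)"
    by (simp only: step_def[abs_def])
  moreover have "flat 2 x * (flat 0 x + flat 0 (1 - x)) - flat 0 x * (flat 2 x + - flat 2 (1 - x)) =
      flat 2 x * flat 0 (1 - x) + flat 0 x * flat 2 (1 - x)"
    by (simp add: ring_distribs)
  ultimately show ?thesis by (simp only: step_deriv_def power2_eq_square)
qed

lemma step_affine_smooth: "(\<lambda>x. step (c * (x - s))) \<in> smooth_funs"
proof -
  have num: "(\<lambda>x. flat 0 (c * x + (- c * s))) \<in> smooth_funs"
    by (rule smooth_funs.flat)
  have "(\<lambda>x. flat 0 ((- c) * x + (1 + c * s))) \<in> smooth_funs"
    by (rule smooth_funs.flat)
  note denom = smooth_funs.add[OF num this]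
  have "flat 0 (c * x + (- c * s)) + flat 0 ((- c) * x + (1 + c * s)) \<noteq> 0" for x
  proof -
    have "(- c) * x + (1 + c * s) = 1 - (c * x + (- c * s))" by simp
    then show ?thesis using step_denom_pos[of "c * x + (- c * s)"] by (simp only:)
  qed
  from smooth_funs.mult[OF num smooth_funs.inverse[OF denom this]]
  have "(\<lambda>x. flat 0 (c * x + (- c * s)) *
      inverse (flat 0 (c * x + (- c * s)) + flat 0 ((- c) * x + (1 + c * s)))) \<in> smooth_funs" .
  moreover have "(\<lambda>x. flat 0 (c * x + (- c * s)) *
      inverse (flat 0 (c * x + (- c * s)) + flat 0 ((- c) * x + (1 + c * s)))) =
      (\<lambda>x. step (c * (x - s)))"
  proof
    fix x
    have "c * x + (- c * s) = c * (x - s)" "(- c) * x + (1 + c * s) = 1 - c * (x - s)"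
      by (simp_all add: right_diff_distrib)
    then show "flat 0 (c * x + (- c * s)) *
      inverse (flat 0 (c * x + (- c * s)) + flat 0 ((- c) * x + (1 + c * s))) = step (c * (x - s))"
      by (simp only: step_def divide_inverse)
  qed
  ultimately show ?thesis by (simp only:)
qed

lemma step_affine_has_derivative:
  "((\<lambda>x. step (c * (x - s))) has_real_derivative c * step_deriv (c * (x - s))) (at x)"
  by (rule DERIV_cong[OF DERIV_chain2[OF step_has_derivative]]) (auto intro!: derivative_eq_intros)

text \<open>
  For large \<open>c\<close> the function approximates the indicator function of the interval from \<open>s\<close> to \<open>t\<close>.
  The smooth transitions take place to the right of \<open>s\<close> and of \<open>t\<close>, hence the room \<open>1 / c\<close> that is
  required at the right end.
\<close>
lemma step_difference_test_function:
  assumes "0 < s" "s < t" "0 < c" "t + 1 / c < T"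
  shows "(\<lambda>x. step (c * (x - s)) - step (c * (x - t))) \<in> test_functions {0<..<T}" (is "?\<phi> \<in> _")
proof -
  have "(\<lambda>x. step (c * (x - s)) + (- 1) * step (c * (x - t))) \<in> smooth_funs"
    by (rule smooth_funs.add[OF step_affine_smooth smooth_funs.mult[OF smooth_funs.const step_affine_smooth]])
  then have "smooth ?\<phi>" by (intro smooth_funs_imp_smooth) simp
  have "{x. ?\<phi> x \<noteq> 0} \<subseteq> {s..t + 1 / c}"
  proof
    fix x assume x: "x \<in> {x. ?\<phi> x \<noteq> 0}"
    have "\<not> x < s"
    proof
      assume "x < s"
      then have "c * (x - s) \<le> 0" "c * (x - t) \<le> 0"
        using assms by (auto simp: mult_nonneg_nonpos)
      then show False using x by (simp add: step_eq_0)
    qed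
    moreover have "\<not> t + 1 / c < x"
    proof
      assume "t + 1 / c < x"
      then have "1 \<le> c * (x - t)" using assms by (simp add: field_simps)
      moreover have "c * (x - t) \<le> c * (x - s)" using assms by simp
      ultimately show False using x by (simp add: step_eq_1)
    qed
    ultimately show "x \<in> {s..t + 1 / c}" by simp
  qed
  then have cl: "closure {x. ?\<phi> x \<noteq> 0} \<subseteq> {s..t + 1 / c}"
    by (meson closed_atLeastAtMost closure_minimal)
  then have "compact (closure {x. ?\<phi> x \<noteq> 0})"
    by (meson closed_closure compact_Icc bounded_subset compact_eq_bounded_closed)
  moreover have "{s..t + 1 / c} \<subseteq> {0<..<T}" using assms by auto
  ultimately show ?thesis using \<open>smooth ?\<phi>\<close> cl by (auto simp: test_functions_def)
qed

section \<open>Weak derivatives on an interval\<close>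

lemma step_deriv_continuous: "continuous_on UNIV step_deriv"
proof -
  have c1: "continuous_on UNIV (flat n)" for n
    using DERIV_isCont[OF flat_has_derivative] by (simp add: continuous_on_eq_continuous_at)
  have c2: "continuous_on UNIV (\<lambda>x. flat n (1 - x))" for n
    by (rule continuous_on_compose2[OF c1]) (auto intro!: continuous_intros)
  have "(flat 0 x + flat 0 (1 - x))\<^sup>2 \<noteq> 0" for x
    using step_denom_pos[of x] by simp
  then show ?thesis
    unfolding step_deriv_def[abs_def]
    by (intro continuous_on_divide continuous_on_add continuous_on_mult continuous_on_power c1 c2 ballI)
qed

lemma step_deriv_affine_continuous: "continuous_on A (\<lambda>x. c * step_deriv (c * (x - s)))"
  by (rule continuous_on_mult[OF continuous_on_const continuous_on_compose2[OF step_deriv_continuous]])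
    (auto intro!: continuous_intros)

text \<open>
  The kernel is nonnegative, has integral one by the fundamental theorem of calculus, and is
  concentrated on the interval from \<open>s\<close> to \<open>s + 1 / c n\<close>, where \<open>a\<close> is close to \<open>a s\<close>.
\<close>
lemma step_deriv_approximates_delta:
  fixes a :: "real \<Rightarrow> real"
  assumes a: "continuous_on {0..T} a" and s: "0 \<le> s" "s < T"
    and c: "filterlim c at_top sequentially"
  shows "(\<lambda>n. LINT x|lebesgue_on {0..T}. a x * (c n * step_deriv (c n * (x - s)))) \<longlonglongrightarrow> a s"
proof (rule LIMSEQ_I)
  fix r :: real assume "0 < r"
  then have r2: "0 < r / 2" by simp
  have "s \<in> {0..T}" using s by simp
  with a r2 obtain d where "0 < d" and d: "\<And>x. x \<in> {0..T} \<Longrightarrow> \<bar>x - s\<bar> < d \<Longrightarrow> \<bar>a x - a s\<bar> < r / 2"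
    unfolding continuous_on_iff dist_real_def by meson
  have "\<forall>\<^sub>F n in sequentially. c n > max (1 / d) (1 / (T - s))"
    using c unfolding filterlim_at_top_dense by blast
  then obtain n0 where n0: "\<And>n. n \<ge> n0 \<Longrightarrow> c n > max (1 / d) (1 / (T - s))"
    by (auto simp: eventually_sequentially)
  have "norm ((LINT x|lebesgue_on {0..T}. a x * (c n * step_deriv (c n * (x - s)))) - a s) < r" if "n \<ge> n0" for n
  proof -
    define k where "k = (\<lambda>x. c n * step_deriv (c n * (x - s)))"
    have cn: "1 / d < c n" "1 / (T - s) < c n" using n0[OF that] by auto
    moreover have "0 < 1 / d" using \<open>0 < d\<close> by simp
    ultimately have "0 < c n" by linarith
    have kcont: "continuous_on {0..T} k"
      unfolding k_def by (rule step_deriv_affine_continuous)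
    have k0: "0 \<le> k x" for x using \<open>0 < c n\<close> step_deriv_nonneg by (simp add: k_def)
    have int: "integrable (lebesgue_on {0..T}) k"
      "integrable (lebesgue_on {0..T}) (\<lambda>x. a x * k x)"
      "integrable (lebesgue_on {0..T}) (\<lambda>x. (a x - a s) * k x)"
      by (intro continuous_imp_integrable_real continuous_on_mult continuous_on_diff
          continuous_on_const kcont a)+
    have "(k has_integral (step (c n * (T - s)) - step (c n * (0 - s)))) {0..T}"
    proof (rule fundamental_theorem_of_calculus)
      show "0 \<le> T" using s by simp
      show "((\<lambda>x. step (c n * (x - s))) has_vector_derivative k x) (at x within {0..T})" for x
        using step_affine_has_derivative[of "c n" s x]
        by (simp add: k_def has_real_derivative_iff_has_vector_derivative has_vector_derivative_at_within)
    qed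
    moreover have "step (c n * (T - s)) = 1"
      using cn s by (intro step_eq_1) (simp add: field_simps)
    moreover have "step (c n * (0 - s)) = 0"
      using \<open>0 < c n\<close> s by (intro step_eq_0) (simp add: mult_nonneg_nonpos)
    ultimately have "(k has_integral 1) {0..T}"
      by simp
    from trans[OF lebesgue_integral_eq_integral[OF int(1)] integral_unique[OF this]]
    have k1: "(LINT x|lebesgue_on {0..T}. k x) = 1" by simp
    have "\<bar>(a x - a s) * k x\<bar> \<le> r / 2 * k x" if "x \<in> {0..T}" for x
    proof (cases "k x = 0")
      case True
      then show ?thesis by simp
    next
      case False
      then have "c n * (x - s) \<in> {0..1}" using step_deriv_eq_0 by (auto simp: k_def)
      then have "0 \<le> x - s" "x - s \<le> 1 / c n"
        using \<open>0 < c n\<close> by (auto simp: zero_le_mult_iff field_simps)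
      moreover have "1 / c n < d" using cn \<open>0 < d\<close> \<open>0 < c n\<close> by (simp add: field_simps)
      ultimately have "\<bar>a x - a s\<bar> < r / 2" using d[OF that] by simp
      then have "\<bar>a x - a s\<bar> * \<bar>k x\<bar> \<le> r / 2 * \<bar>k x\<bar>" by (intro mult_right_mono) auto
      then show ?thesis using k0[of x] by (simp only: abs_mult abs_of_nonneg)
    qed
    then have "\<bar>LINT x|lebesgue_on {0..T}. (a x - a s) * k x\<bar> \<le> (LINT x|lebesgue_on {0..T}. r / 2 * k x)"
      using int by (intro integral_abs_bound_integral) auto
    also have "\<dots> = r / 2" by (simp only: k1 integral_mult_right_zero mult_1_right)
    finally have le: "\<bar>LINT x|lebesgue_on {0..T}. (a x - a s) * k x\<bar> \<le> r / 2" .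
    have "(LINT x|lebesgue_on {0..T}. (a x - a s) * k x) =
        (LINT x|lebesgue_on {0..T}. a x * k x - a s * k x)"
      by (simp only: left_diff_distrib)
    also have "\<dots> = (LINT x|lebesgue_on {0..T}. a x * k x) - a s * (LINT x|lebesgue_on {0..T}. k x)"
      using int by (subst Bochner_Integration.integral_diff) auto
    finally have "\<bar>(LINT x|lebesgue_on {0..T}. a x * k x) - a s\<bar> < r"
      using le \<open>0 < r\<close> by (simp add: k1)
    then show ?thesis by (simp add: k_def)
  qed
  then show "\<exists>no. \<forall>n\<ge>no. norm ((LINT x|lebesgue_on {0..T}. a x * (c n * step_deriv (c n * (x - s)))) - a s) < r"
    by blast
qed

text \<open>
  Test with smooth approximations of the indicator function of \<open>{s..t}\<close>. Their derivatives
  approximate the difference of the Dirac measures at \<open>s\<close> and \<open>t\<close>, so one side of the weak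
  formulation tends to \<open>a s - a t\<close>; the other side converges by dominated convergence.
\<close>
lemma weak_derivative_imp_integral_interior:
  fixes a b :: "real \<Rightarrow> real"
  assumes a: "continuous_on {0..T} a" and b: "integrable (lebesgue_on {0..T}) b"
    and weak: "\<And>\<phi>. \<phi> \<in> test_functions {0<..<T} \<Longrightarrow>
      (LINT t|lebesgue_on {0..T}. a t * deriv \<phi> t) = - (LINT t|lebesgue_on {0..T}. b t * \<phi> t)"
    and st: "0 < s" "s < t" "t < T"
  shows "a t - a s = (LINT x|lebesgue_on {s..t}. b x)"
proof -
  \<comment> \<open>This scale leaves room for the right-hand transition, since \<open>1 / c n \<le> (T - t) / 2\<close>.\<close>
  define c where "c n = 1 / (T - t) * real (n + 2)" for n
  have c_lim: "filterlim c at_top sequentially"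
    unfolding c_def using st
    by (intro filterlim_tendsto_pos_mult_at_top[OF tendsto_const]
        filterlim_compose[OF filterlim_real_sequentially filterlim_add_const_nat_at_top]) auto
  define \<phi> where "\<phi> n x = step (c n * (x - s)) - step (c n * (x - t))" for n x
  have c_pos: "0 < c n" for n using st by (simp add: c_def)
  have test: "\<phi> n \<in> test_functions {0<..<T}" for n
    unfolding \<phi>_def[abs_def]
  proof (rule step_difference_test_function[OF st(1,2) c_pos])
    have "1 / c n = (T - t) / real (n + 2)" by (simp add: c_def)
    also have "\<dots> \<le> (T - t) / 2" using st by (intro divide_left_mono) auto
    finally have "1 / c n \<le> (T - t) / 2" .
    then show "t + 1 / c n < T" using st by (simp add: field_simps)
  qed
  have phi_deriv: "(\<phi> n has_real_derivative
      c n * step_deriv (c n * (x - s)) - c n * step_deriv (c n * (x - t))) (at x)" for n x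
    unfolding \<phi>_def[abs_def] by (intro DERIV_diff step_affine_has_derivative)
  have deriv: "deriv (\<phi> n) x = c n * step_deriv (c n * (x - s)) - c n * step_deriv (c n * (x - t))" for n x
    by (rule DERIV_imp_deriv[OF phi_deriv])
  have int: "integrable (lebesgue_on {0..T}) (\<lambda>x. a x * (c n * step_deriv (c n * (x - r))))" for n r
    by (rule continuous_imp_integrable_real[OF continuous_on_mult[OF a step_deriv_affine_continuous]])
  have "(LINT x|lebesgue_on {0..T}. a x * deriv (\<phi> n) x) =
      (LINT x|lebesgue_on {0..T}. a x * (c n * step_deriv (c n * (x - s)))) -
      (LINT x|lebesgue_on {0..T}. a x * (c n * step_deriv (c n * (x - t))))" for n
    unfolding deriv right_diff_distrib by (intro Bochner_Integration.integral_diff int[unfolded right_diff_distrib])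
  then have lim1: "(\<lambda>n. LINT x|lebesgue_on {0..T}. a x * deriv (\<phi> n) x) \<longlonglongrightarrow> a s - a t"
    using st by (simp only:) (intro tendsto_diff step_deriv_approximates_delta a c_lim; simp)
  have "(\<lambda>n. LINT x|lebesgue_on {0..T}. b x * \<phi> n x) \<longlonglongrightarrow>
      (LINT x|lebesgue_on {0..T}. (if x \<in> {s..t} then b x else 0))"
  proof (rule integral_dominated_convergence[where w = "\<lambda>x. norm (b x)"])
    show "(\<lambda>x. if x \<in> {s..t} then b x else 0) \<in> borel_measurable (lebesgue_on {0..T})"
      using integrable_subinterval[OF b, of s t] st
      by (subst borel_measurable_if_lebesgue_on) (auto intro: borel_measurable_integrable)
    show "integrable (lebesgue_on {0..T}) (\<lambda>x. norm (b x))" using b by simp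
    have "continuous_on UNIV (\<phi> n)" for n
      using DERIV_isCont[OF phi_deriv] by (simp add: continuous_on_eq_continuous_at)
    then have "\<phi> n \<in> borel_measurable (lebesgue_on {0..T})" for n
      by (intro continuous_imp_measurable_on_sets_lebesgue) (auto intro: continuous_on_subset)
    then show "(\<lambda>x. b x * \<phi> n x) \<in> borel_measurable (lebesgue_on {0..T})" for n
      using b by (intro borel_measurable_times) auto
    show "AE x in lebesgue_on {0..T}. norm (b x * \<phi> n x) \<le> norm (b x)" for n
    proof (rule AE_I2)
      fix x
      have "\<bar>\<phi> n x\<bar> \<le> 1"
        using step_bounds[of "c n * (x - s)"] step_bounds[of "c n * (x - t)"] by (simp add: \<phi>_def)
      then show "norm (b x * \<phi> n x) \<le> norm (b x)" by (simp add: abs_mult mult_left_le)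
    qed
    have lim: "(\<lambda>n. step (c n * (x - r))) \<longlonglongrightarrow> (if x > r then 1 else 0)" for x r
    proof (cases "x > r")
      case True
      then have "filterlim (\<lambda>n. c n * (x - r)) at_top sequentially"
        using c_lim by (intro filterlim_at_top_mult_tendsto_pos[OF tendsto_const]) (auto simp: mult.commute)
      then have "\<forall>\<^sub>F n in sequentially. 1 \<le> c n * (x - r)" by (simp add: filterlim_at_top)
      then have "\<forall>\<^sub>F n in sequentially. step (c n * (x - r)) = 1"
        by eventually_elim (rule step_eq_1)
      then show ?thesis using True by (simp add: tendsto_eventually)
    next
      case False
      then have "step (c n * (x - r)) = 0" for n
        using c_pos[of n] by (intro step_eq_0) (simp add: mult_nonneg_nonpos)
      then show ?thesis using False by simp
    qed
    have "AE x in lebesgue_on {0..T}. x \<noteq> s"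
    proof (rule AE_I[of _ _ "{s}"])
      show "emeasure (lebesgue_on {0..T}) {s} = 0" using st by (simp add: emeasure_restrict_space)
    qed (use st in \<open>auto simp: sets_restrict_space_iff\<close>)
    then show "AE x in lebesgue_on {0..T}. (\<lambda>n. b x * \<phi> n x) \<longlonglongrightarrow> (if x \<in> {s..t} then b x else 0)"
    proof eventually_elim
      case (elim x)
      have "(\<lambda>n. b x * \<phi> n x) \<longlonglongrightarrow> b x * ((if x > s then 1 else 0) - (if x > t then 1 else 0))"
        unfolding \<phi>_def by (intro tendsto_intros lim)
      also have "b x * ((if x > s then 1 else 0) - (if x > t then 1 else 0)) =
          (if x \<in> {s..t} then b x else 0)"
        using elim st by auto
      finally show ?case .
    qed
  qed
  moreover have "(LINT x|lebesgue_on {0..T}. (if x \<in> {s..t} then b x else 0)) = (LINT x|lebesgue_on {s..t}. b x)"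
    using st by (intro integral_restrict) auto
  ultimately have lim2: "(\<lambda>n. LINT x|lebesgue_on {0..T}. b x * \<phi> n x) \<longlonglongrightarrow> (LINT x|lebesgue_on {s..t}. b x)"
    by simp
  have "(\<lambda>n. LINT x|lebesgue_on {0..T}. a x * deriv (\<phi> n) x) \<longlonglongrightarrow> - (LINT x|lebesgue_on {s..t}. b x)"
    unfolding weak[OF test] by (intro tendsto_minus lim2)
  from LIMSEQ_unique[OF lim1 this] show ?thesis by simp
qed

text \<open>
  Both sides are continuous in \<open>s\<close> and \<open>t\<close>, which allows them to reach the end points of the interval.
\<close>
lemma weak_derivative_imp_integral:
  fixes a b :: "real \<Rightarrow> real"
  assumes a: "continuous_on {0..T} a" and b: "integrable (lebesgue_on {0..T}) b"
    and weak: "\<And>\<phi>. \<phi> \<in> test_functions {0<..<T} \<Longrightarrow>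
      (LINT t|lebesgue_on {0..T}. a t * deriv \<phi> t) = - (LINT t|lebesgue_on {0..T}. b t * \<phi> t)"
    and st: "0 \<le> s" "s \<le> t" "t \<le> T"
  shows "a t - a s = (LINT x|lebesgue_on {s..t}. b x)"
proof (cases "s = t")
  case True
  have "(LINT x|lebesgue_on {t}. b x) = 0"
    by (rule integral_eq_zero_null_sets) simp
  then show ?thesis using True by simp
next
  case False
  then have "0 < T" using st by simp
  define D where "D x = a x - (LINT y|lebesgue_on {0..x}. b y)" for x
  have split: "(LINT y|lebesgue_on {0..q}. b y) - (LINT y|lebesgue_on {0..p}. b y) = (LINT y|lebesgue_on {p..q}. b y)"
    if "0 \<le> p" "p \<le> q" "q \<le> T" for p q
    using integral_combine[OF integrable_subinterval[OF b, of 0 q], of p] that by simp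
  have Dc: "continuous_on {0..T} D"
    unfolding D_def[abs_def] by (intro continuous_on_diff a indefinite_integral_continuous_real b)
  have eq: "D p = D q" if "0 < p" "p < q" "q < T" for p q
    using weak_derivative_imp_integral_interior[OF a b weak that] split[of p q] that by (simp add: D_def)
  have "D x = D (T / 2)" if "x \<in> {0..T}" for x
  proof (rule continuous_constant_on_closure[of "{0<..<T}" D])
    show "continuous_on (closure {0<..<T}) D" using Dc \<open>0 < T\<close> by simp
    show "x \<in> closure {0<..<T}" using that \<open>0 < T\<close> by simp
    show "D y = D (T / 2)" if "y \<in> {0<..<T}" for y
    proof (rule linorder_cases[of y "T / 2"])
      assume "y < T / 2"
      then show ?thesis using eq[of y "T / 2"] that by simp
    next
      assume "T / 2 < y"
      then show ?thesis using eq[of "T / 2" y] that by simp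
    qed (simp only:)
  qed
  from this[of s] this[of t] have "D s = D t" using st by simp
  then show ?thesis using split[OF st] by (simp add: D_def)
qed

section \<open>The product rule for indefinite integrals\<close>

lemma integrable_mult_continuous:
  fixes b c :: "real \<Rightarrow> real"
  assumes b: "integrable (lebesgue_on {0..T}) b" and c: "continuous_on {0..T} c"
  shows "integrable (lebesgue_on {0..T}) (\<lambda>x. b x * c x)"
proof -
  have "compact (c ` {0..T})" by (intro compact_continuous_image c compact_Icc)
  then obtain K where K: "\<forall>x\<in>{0..T}. \<bar>c x\<bar> \<le> K"
    by (auto dest!: compact_imp_bounded simp: bounded_iff)
  show ?thesis
  proof (rule Bochner_Integration.integrable_bound)
    show "integrable (lebesgue_on {0..T}) (\<lambda>x. \<bar>b x\<bar> * K)" using b by simp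
    show "(\<lambda>x. b x * c x) \<in> borel_measurable (lebesgue_on {0..T})"
      by (intro borel_measurable_times borel_measurable_integrable[OF b]
          continuous_imp_measurable_on_sets_lebesgue[OF c]) simp
    show "AE x in lebesgue_on {0..T}. norm (b x * c x) \<le> norm (\<bar>b x\<bar> * K)"
    proof (rule AE_I2)
      fix x assume "x \<in> space (lebesgue_on {0..T})"
      with K have "\<bar>c x\<bar> \<le> K" by simp
      then have "\<bar>c x\<bar> \<le> \<bar>K\<bar>" by linarith
      then show "norm (b x * c x) \<le> norm (\<bar>b x\<bar> * K)"
        by (simp add: abs_mult mult_left_mono)
    qed
  qed
qed

text \<open>
  On a short interval from \<open>p\<close> to \<open>q\<close>,
  \<open>a q * c q - a p * c p = (a q - a p) * c q + a p * (c q - c p)\<close> differs from the integral on the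
  right by at most \<open>e\<close> times the integral of \<open>\<bar>b\<bar> + \<bar>d\<bar>\<close>, by uniform continuity of \<open>a\<close> and \<open>c\<close>. This
  bound is additive in the interval, so it extends to long intervals, and \<open>e\<close> is arbitrary.
\<close>
lemma integral_product_rule:
  fixes a b c d :: "real \<Rightarrow> real"
  assumes b: "integrable (lebesgue_on {0..T}) b" and d: "integrable (lebesgue_on {0..T}) d"
    and a: "continuous_on {0..T} a" and c: "continuous_on {0..T} c"
    and ab: "\<And>s t. 0 \<le> s \<Longrightarrow> s \<le> t \<Longrightarrow> t \<le> T \<Longrightarrow> a t - a s = (LINT x|lebesgue_on {s..t}. b x)"
    and cd: "\<And>s t. 0 \<le> s \<Longrightarrow> s \<le> t \<Longrightarrow> t \<le> T \<Longrightarrow> c t - c s = (LINT x|lebesgue_on {s..t}. d x)"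
    and t: "0 \<le> t" "t \<le> T"
  shows "a t * c t - a 0 * c 0 = (LINT x|lebesgue_on {0..t}. b x * c x + d x * a x)"
proof -
  define h where "h x = b x * c x + d x * a x" for x
  define g where "g x = \<bar>b x\<bar> + \<bar>d x\<bar>" for x
  define D where "D p q = a q * c q - a p * c p - (LINT x|lebesgue_on {p..q}. h x)" for p q
  have h: "integrable (lebesgue_on {0..T}) h"
    unfolding h_def[abs_def] by (intro Bochner_Integration.integrable_add integrable_mult_continuous a b c d)
  have g: "integrable (lebesgue_on {0..T}) g"
    unfolding g_def[abs_def] by (intro Bochner_Integration.integrable_add integrable_abs b d)
  have sub: "integrable (lebesgue_on {p..q}) k" if "integrable (lebesgue_on {0..T}) k" "0 \<le> p" "q \<le> T"
    for p q and k :: "real \<Rightarrow> real"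
    using that by (intro integrable_subinterval[OF that(1)]) auto
  have small: "\<bar>D 0 t\<bar> \<le> e * (LINT x|lebesgue_on {0..t}. g x)" if "0 < e" for e
  proof -
    have "uniformly_continuous_on {0..T} a" "uniformly_continuous_on {0..T} c"
      using a c by (auto intro: compact_uniformly_continuous)
    then have "\<exists>d1>0. \<forall>x\<in>{0..T}. \<forall>y\<in>{0..T}. dist y x < d1 \<longrightarrow> dist (a y) (a x) < e"
      "\<exists>d2>0. \<forall>x\<in>{0..T}. \<forall>y\<in>{0..T}. dist y x < d2 \<longrightarrow> dist (c y) (c x) < e"
      using \<open>0 < e\<close> unfolding uniformly_continuous_on_def by blast+
    then obtain d1 d2 where "0 < d1" "0 < d2"
      and d1: "\<forall>x\<in>{0..T}. \<forall>y\<in>{0..T}. dist y x < d1 \<longrightarrow> dist (a y) (a x) < e"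
      and d2: "\<forall>x\<in>{0..T}. \<forall>y\<in>{0..T}. dist y x < d2 \<longrightarrow> dist (c y) (c x) < e"
      by blast
    \<comment> \<open>Bolzano's principle replaces a subdivision into short intervals.\<close>
    have "0 \<le> (0::real) \<and> t \<le> T \<longrightarrow> \<bar>D 0 t\<bar> \<le> e * (LINT x|lebesgue_on {0..t}. g x)"
    proof (rule Bolzano[where P = "\<lambda>p q. 0 \<le> p \<and> q \<le> T \<longrightarrow> \<bar>D p q\<bar> \<le> e * (LINT x|lebesgue_on {p..q}. g x)"])
      show "0 \<le> t" by (rule t(1))
      fix p q r :: real
      assume trans: "0 \<le> p \<and> q \<le> T \<longrightarrow> \<bar>D p q\<bar> \<le> e * (LINT x|lebesgue_on {p..q}. g x)"
        "0 \<le> q \<and> r \<le> T \<longrightarrow> \<bar>D q r\<bar> \<le> e * (LINT x|lebesgue_on {q..r}. g x)" "p \<le> q" "q \<le> r"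
      show "0 \<le> p \<and> r \<le> T \<longrightarrow> \<bar>D p r\<bar> \<le> e * (LINT x|lebesgue_on {p..r}. g x)"
      proof
        assume pr: "0 \<le> p \<and> r \<le> T"
        have comb: "(LINT x|lebesgue_on {p..r}. k x) =
            (LINT x|lebesgue_on {p..q}. k x) + (LINT x|lebesgue_on {q..r}. k x)"
          if "integrable (lebesgue_on {0..T}) k" for k :: "real \<Rightarrow> real"
          by (rule integral_combine[OF sub[OF that]]) (use trans pr in auto)
        have "D p r = D p q + D q r" unfolding D_def comb[OF h] by simp
        moreover have "\<bar>D p q\<bar> \<le> e * (LINT x|lebesgue_on {p..q}. g x)"
          "\<bar>D q r\<bar> \<le> e * (LINT x|lebesgue_on {q..r}. g x)"
          using trans pr by auto
        ultimately show "\<bar>D p r\<bar> \<le> e * (LINT x|lebesgue_on {p..r}. g x)"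
          unfolding comb[OF g] distrib_left by linarith
      qed
    next
      fix x :: real
      show "\<exists>d>0. \<forall>p q. p \<le> x \<and> x \<le> q \<and> q - p < d \<longrightarrow>
          0 \<le> p \<and> q \<le> T \<longrightarrow> \<bar>D p q\<bar> \<le> e * (LINT x|lebesgue_on {p..q}. g x)"
      proof (intro exI[of _ "min d1 d2"] conjI allI impI)
        show "0 < min d1 d2" using \<open>0 < d1\<close> \<open>0 < d2\<close> by simp
        fix p q assume "p \<le> x \<and> x \<le> q \<and> q - p < min d1 d2" "0 \<le> p \<and> q \<le> T"
        then have pq: "0 \<le> p" "p \<le> q" "q \<le> T" "q - p < d1" "q - p < d2" by auto
        note int = sub[OF _ pq(1,3)]
        have "a q * c q - a p * c p = (a q - a p) * c q + a p * (c q - c p)"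
          by (simp add: algebra_simps)
        also have "\<dots> = (LINT x|lebesgue_on {p..q}. b x * c q + a p * d x)"
          unfolding ab[OF pq(1-3)] cd[OF pq(1-3)] using int[OF b] int[OF d] by simp
        finally have "D p q = (LINT x|lebesgue_on {p..q}. (b x * c q + a p * d x) - h x)"
          unfolding D_def using int[OF b] int[OF d] int[OF h] by simp
        also have "\<bar>\<dots>\<bar> \<le> (LINT x|lebesgue_on {p..q}. e * g x)"
        proof (rule integral_abs_bound_integral)
          show "integrable (lebesgue_on {p..q}) (\<lambda>x. (b x * c q + a p * d x) - h x)"
            "integrable (lebesgue_on {p..q}) (\<lambda>x. e * g x)"
            using int[OF b] int[OF d] int[OF h] int[OF g] by auto
          fix y assume "y \<in> space (lebesgue_on {p..q})"
          then have "\<bar>c q - c y\<bar> \<le> e" "\<bar>a p - a y\<bar> \<le> e"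
            using d1[rule_format, of y p] d2[rule_format, of y q] pq by (auto simp: dist_real_def)
          then have "\<bar>b y * (c q - c y)\<bar> \<le> \<bar>b y\<bar> * e" "\<bar>d y * (a p - a y)\<bar> \<le> \<bar>d y\<bar> * e"
            by (simp_all add: abs_mult mult_left_mono)
          moreover have "(b y * c q + a p * d y) - h y = b y * (c q - c y) + d y * (a p - a y)"
            by (simp add: h_def algebra_simps)
          moreover have "e * g y = \<bar>b y\<bar> * e + \<bar>d y\<bar> * e" by (simp add: g_def algebra_simps)
          ultimately show "\<bar>(b y * c q + a p * d y) - h y\<bar> \<le> e * g y" by linarith
        qed
        finally show "\<bar>D p q\<bar> \<le> e * (LINT x|lebesgue_on {p..q}. g x)" by simp
      qed
    qed
    then show ?thesis using t by simp
  qed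
  have "D 0 t = 0"
  proof (rule ccontr)
    assume "D 0 t \<noteq> 0"
    let ?K = "LINT x|lebesgue_on {0..t}. g x"
    have K: "0 \<le> ?K" by (intro integral_nonneg_AE) (simp add: g_def)
    \<comment> \<open>The choice of \<open>e\<close> makes the bound smaller than \<open>\<bar>D 0 t\<bar>\<close> itself.\<close>
    have "\<bar>D 0 t\<bar> \<le> \<bar>D 0 t\<bar> / (2 * (?K + 1)) * ?K"
      using \<open>D 0 t \<noteq> 0\<close> K by (intro small) simp
    also have "\<dots> = \<bar>D 0 t\<bar> * (?K / (2 * (?K + 1)))" by simp
    also have "\<dots> < \<bar>D 0 t\<bar> * 1"
      using \<open>D 0 t \<noteq> 0\<close> K by (intro mult_strict_left_mono) (auto simp: field_simps)
    finally show False by simp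
  qed
  then show ?thesis by (simp add: D_def h_def)
qed

section \<open>Inner products of polynomials in terms of point values\<close>

text \<open>
  A member of a finite-dimensional space of functions is determined, linearly, by its values at
  finitely many points. When a spanning function \<open>m j\<close> is added, the old representation
  fails by a multiple of a fixed function \<open>r\<close>; unless \<open>r\<close> vanishes, one new point \<open>y\<close> with
  \<open>r y \<noteq> 0\<close> determines this multiple.
\<close>
lemma evaluation_points_exist:
  fixes m :: "'i \<Rightarrow> 'x::topological_space \<Rightarrow> real"
  assumes "finite I" "\<And>i. i \<in> I \<Longrightarrow> continuous_on X (m i)"
  shows "\<exists>S L. finite S \<and> S \<subseteq> X \<and> (\<forall>s\<in>S. continuous_on X (L s)) \<and>
    (\<forall>c. \<forall>x\<in>X. (\<Sum>i\<in>I. c i * m i x) = (\<Sum>s\<in>S. (\<Sum>i\<in>I. c i * m i s) * L s x))"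
  using assms
proof (induction rule: finite_induct)
  case empty
  show ?case by (intro exI[of _ "{}"]) simp
next
  case (insert j I)
  have "\<exists>S L. finite S \<and> S \<subseteq> X \<and> (\<forall>s\<in>S. continuous_on X (L s)) \<and>
      (\<forall>c. \<forall>x\<in>X. (\<Sum>i\<in>I. c i * m i x) = (\<Sum>s\<in>S. (\<Sum>i\<in>I. c i * m i s) * L s x))"
    by (rule insert.IH) (rule insert.prems, simp)
  then obtain S L where "finite S \<and> S \<subseteq> X \<and> (\<forall>s\<in>S. continuous_on X (L s)) \<and>
      (\<forall>c. \<forall>x\<in>X. (\<Sum>i\<in>I. c i * m i x) = (\<Sum>s\<in>S. (\<Sum>i\<in>I. c i * m i s) * L s x))"
    by (elim exE)
  then have S: "finite S" "S \<subseteq> X" and L: "\<And>s. s \<in> S \<Longrightarrow> continuous_on X (L s)"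
    and rep: "\<And>c x. x \<in> X \<Longrightarrow> (\<Sum>i\<in>I. c i * m i x) = (\<Sum>s\<in>S. (\<Sum>i\<in>I. c i * m i s) * L s x)"
    by blast+
  define r where "r x = m j x - (\<Sum>s\<in>S. m j s * L s x)" for x
  define p where "p c x = (\<Sum>i\<in>insert j I. c i * m i x)" for c x
  have p_eq: "p c x = c j * m j x + (\<Sum>i\<in>I. c i * m i x)" for c x
    using insert by (simp add: p_def)
  have defect: "p c x - (\<Sum>s\<in>S. p c s * L s x) = c j * r x" if "x \<in> X" for c x
    unfolding p_eq r_def rep[OF that]
    by (simp add: algebra_simps sum.distrib sum_distrib_left)
  have r: "continuous_on X r"
    unfolding r_def[abs_def] using L insert.prems by (intro continuous_intros) auto
  show ?case
  proof (cases "\<forall>x\<in>X. r x = 0")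
    case True
    then have "p c x = (\<Sum>s\<in>S. p c s * L s x)" if "x \<in> X" for c x
      using defect[OF that, of c] that by simp
    then show ?thesis
      unfolding p_def by (intro exI[of _ S] exI[of _ L] conjI allI ballI S L)
  next
    case False
    then obtain y where y: "y \<in> X" "r y \<noteq> 0" by blast
    \<comment> \<open>The two summands allow for the case that \<open>y\<close> is already one of the points.\<close>
    define L' where "L' s x = (if s \<in> S then L s x - L s y * (r x / r y) else 0) +
        (if s = y then r x / r y else 0)" for s x
    have "continuous_on X (L' s)" for s
    proof -
      have "continuous_on X (\<lambda>x. r x / r y)" using y by (intro continuous_intros r) auto
      then show ?thesis
        unfolding L'_def[abs_def] using L[of s]
        by (cases "s \<in> S"; cases "s = y")
            (auto intro!: continuous_on_add continuous_on_diff continuous_on_mult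
              simp del: times_divide_eq_right)
    qed
    moreover have "p c x = (\<Sum>s\<in>insert y S. p c s * L' s x)" if "x \<in> X" for c x
    proof -
      have "(\<Sum>s\<in>insert y S. p c s * L' s x) =
          (\<Sum>s\<in>insert y S. if s \<in> S then p c s * (L s x - L s y * (r x / r y)) else 0) +
          (\<Sum>s\<in>insert y S. if s = y then p c y * (r x / r y) else 0)"
        unfolding L'_def sum.distrib[symmetric]
        by (intro sum.cong refl) (simp add: distrib_left)
      also have "(\<Sum>s\<in>insert y S. if s \<in> S then p c s * (L s x - L s y * (r x / r y)) else 0) =
          (\<Sum>s\<in>S. p c s * (L s x - L s y * (r x / r y)))"
        using S by (intro sum.mono_neutral_cong_right) auto
      also have "\<dots> = (\<Sum>s\<in>S. p c s * L s x) - (\<Sum>s\<in>S. p c s * L s y) * (r x / r y)"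
        by (simp only: right_diff_distrib sum_subtractf sum_distrib_right mult.assoc)
      also have "(\<Sum>s\<in>insert y S. if s = y then p c y * (r x / r y) else 0) = p c y * (r x / r y)"
        using S by (subst sum.delta) auto
      finally have "(\<Sum>s\<in>insert y S. p c s * L' s x) =
          (\<Sum>s\<in>S. p c s * L s x) + (p c y - (\<Sum>s\<in>S. p c s * L s y)) * (r x / r y)"
        by (simp add: left_diff_distrib diff_divide_distrib)
      also have "\<dots> = (\<Sum>s\<in>S. p c s * L s x) + c j * r x"
        unfolding defect[OF y(1)] using y by simp
      also have "\<dots> = p c x" using defect[OF that, of c] by simp
      finally show ?thesis ..
    qed
    ultimately show ?thesis
      unfolding p_def using S y by (intro exI[of _ "insert y S"] exI[of _ L'] conjI allI ballI) simp_all
  qed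
qed

lemma integrable_continuous_on_compact:
  fixes g :: "'a::euclidean_space \<Rightarrow> real"
  assumes "compact K" "continuous_on K g"
  shows "integrable (lebesgue_on K) g"
proof -
  have lb: "integrable lborel (\<lambda>x. indicator K x *\<^sub>R g x)"
    by (rule borel_integrable_compact[OF assms])
  then have "integrable lebesgue (\<lambda>x. indicator K x *\<^sub>R g x)"
    using integrable_completion[OF borel_measurable_integrable[OF lb]] lb by blast
  then show ?thesis
    using assms by (simp add: integrable_restrict_space borel_compact)
qed

lemma finite_multi_indices: "finite {\<alpha> :: 'd::finite \<Rightarrow> nat. (\<Sum>i\<in>UNIV. \<alpha> i) \<le> k}"
proof (rule finite_subset)
  show "{\<alpha> :: 'd \<Rightarrow> nat. (\<Sum>i\<in>UNIV. \<alpha> i) \<le> k} \<subseteq> (\<Pi>\<^sub>E i\<in>UNIV. {..k})"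
  proof
    fix \<alpha> :: "'d \<Rightarrow> nat" assume \<alpha>: "\<alpha> \<in> {\<alpha>. (\<Sum>i\<in>UNIV. \<alpha> i) \<le> k}"
    have "\<alpha> i \<le> (\<Sum>i\<in>UNIV. \<alpha> i)" for i by (rule member_le_sum) auto
    with \<alpha> show "\<alpha> \<in> (\<Pi>\<^sub>E i\<in>UNIV. {..k})" by (auto intro: order_trans)
  qed
qed (simp add: finite_PiE)

text \<open>
  Expand both factors in the functions \<open>L\<close> belonging to the evaluation points; \<open>G\<close> is the Gram
  matrix of these functions.
\<close>
lemma polys_inner_product_point_values:
  fixes K :: "(real ^ 'd) set"
  assumes K: "compact K"
  shows "\<exists>S G. finite S \<and> S \<subseteq> K \<and> (\<forall>p\<in>polys k. \<forall>q\<in>polys k.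
    (LINT x|lebesgue_on K. p x * q x) = (\<Sum>y\<in>S. \<Sum>z\<in>S. G y z * (p y * q z)))"
proof -
  let ?I = "{\<alpha> :: 'd \<Rightarrow> nat. (\<Sum>i\<in>UNIV. \<alpha> i) \<le> k}"
  let ?m = "\<lambda>\<alpha> x. \<Prod>i\<in>UNIV. (x $ i) ^ \<alpha> i"
  have "continuous_on K (?m \<alpha>)" for \<alpha> :: "'d \<Rightarrow> nat" by (intro continuous_intros)
  then have "\<exists>S L. finite S \<and> S \<subseteq> K \<and> (\<forall>s\<in>S. continuous_on K (L s)) \<and>
      (\<forall>c. \<forall>x\<in>K. (\<Sum>\<alpha>\<in>?I. c \<alpha> * ?m \<alpha> x) = (\<Sum>s\<in>S. (\<Sum>\<alpha>\<in>?I. c \<alpha> * ?m \<alpha> s) * L s x))"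
    by (intro evaluation_points_exist finite_multi_indices)
  then obtain S L where SL: "finite S \<and> S \<subseteq> K \<and> (\<forall>s\<in>S. continuous_on K (L s)) \<and>
      (\<forall>c. \<forall>x\<in>K. (\<Sum>\<alpha>\<in>?I. c \<alpha> * ?m \<alpha> x) = (\<Sum>s\<in>S. (\<Sum>\<alpha>\<in>?I. c \<alpha> * ?m \<alpha> s) * L s x))"
    by (elim exE)
  then have L: "\<And>s. s \<in> S \<Longrightarrow> continuous_on K (L s)" by blast
  have rep: "p x = (\<Sum>s\<in>S. p s * L s x)" if "p \<in> polys k" "x \<in> K" for p x
    using that SL unfolding polys_def by auto
  have "(LINT x|lebesgue_on K. p x * q x) =
      (\<Sum>y\<in>S. \<Sum>z\<in>S. (LINT x|lebesgue_on K. L y x * L z x) * (p y * q z))"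
    if p: "p \<in> polys k" and q: "q \<in> polys k" for p q
  proof -
    have int: "integrable (lebesgue_on K) (\<lambda>x. L y x * L z x * (p y * q z))" if "y \<in> S" "z \<in> S" for y z
      using that by (intro integrable_mult_left integrable_continuous_on_compact K continuous_on_mult L)
    have "(LINT x|lebesgue_on K. p x * q x) =
        (LINT x|lebesgue_on K. (\<Sum>y\<in>S. \<Sum>z\<in>S. L y x * L z x * (p y * q z)))"
    proof (rule Bochner_Integration.integral_cong[OF refl])
      fix x assume "x \<in> space (lebesgue_on K)"
      then have "x \<in> K" by simp
      show "p x * q x = (\<Sum>y\<in>S. \<Sum>z\<in>S. L y x * L z x * (p y * q z))"
        unfolding rep[OF p \<open>x \<in> K\<close>] rep[OF q \<open>x \<in> K\<close>] sum_product
        by (intro sum.cong refl) simp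
    qed
    also have "\<dots> = (\<Sum>y\<in>S. LINT x|lebesgue_on K. (\<Sum>z\<in>S. L y x * L z x * (p y * q z)))"
      by (intro Bochner_Integration.integral_sum Bochner_Integration.integrable_sum int)
    also have "\<dots> = (\<Sum>y\<in>S. \<Sum>z\<in>S. LINT x|lebesgue_on K. L y x * L z x * (p y * q z))"
      by (intro sum.cong refl Bochner_Integration.integral_sum int)
    finally show ?thesis by simp
  qed
  then show ?thesis
    using SL by (intro exI[of _ S] exI[of _ "\<lambda>y z. LINT x|lebesgue_on K. L y x * L z x"]) blast
qed

section \<open>Integration over the elements of a mesh\<close>

lemma cell_compact: "cell m S \<Longrightarrow> compact S"
  unfolding cell_def by (auto intro: compact_Union polytope_imp_compact)

lemma cell_nonempty: "cell m S \<Longrightarrow> 0 \<le> m \<Longrightarrow> S \<noteq> {}"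
  unfolding cell_def using aff_dim_empty_eq by force

lemma cell_frontier_negligible:
  fixes S :: "'a::euclidean_space set"
  assumes "cell m S"
  shows "negligible (frontier S)"
proof -
  obtain \<P> where P: "finite \<P>" "\<And>P. P \<in> \<P> \<Longrightarrow> polytope P" "S = \<Union>\<P>"
    using assms unfolding cell_def by blast
  have "negligible (\<Union>(frontier ` \<P>))"
    using P by (intro negligible_Union) (auto intro: negligible_convex_frontier polytope_imp_convex)
  moreover have "frontier S \<subseteq> \<Union>(frontier ` \<P>)"
    unfolding P(3) using frontier_Union_subset[OF P(1)] by blast
  ultimately show ?thesis by (rule negligible_subset)
qed

text \<open>
  A polyhedral domain is regular open, being the interior of a closed set; in particular it has
  no slits.
\<close>
lemma interior_closure_polyhedral_domain:
  assumes "polyhedral_domain \<Omega>"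
  shows "interior (closure \<Omega>) \<subseteq> \<Omega>"
proof -
  obtain S where S: "cell (int DIM('a)) S" "\<Omega> = interior S"
    using assms unfolding polyhedral_domain_def by blast
  then have "closure \<Omega> \<subseteq> S"
    using closure_minimal[OF interior_subset compact_imp_closed[OF cell_compact]] by blast
  then show ?thesis using S(2) interior_mono by blast
qed

lemma absolutely_integrable_on_iff_integrable_lebesgue_on:
  fixes g :: "'a::euclidean_space \<Rightarrow> real"
  assumes "S \<in> sets lebesgue"
  shows "g absolutely_integrable_on S \<longleftrightarrow> integrable (lebesgue_on S) g"
  using assms by (simp add: set_integrable_def integrable_restrict_space)

text \<open>
  The elements overlap only in their boundaries. Their union is the closure of \<open>\<Omega>\<close>, and it exceeds
  \<open>\<Omega>\<close> only by points on the boundaries of elements, because \<open>\<Omega>\<close> contains every interior point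
  of its closure.
\<close>
lemma sum_integral_elements:
  fixes g :: "'a::euclidean_space \<Rightarrow> real"
  assumes dom: "polyhedral_domain \<Omega>" and part: "partition_of \<Omega> M"
    and g: "integrable (lebesgue_on \<Omega>) g"
  shows "T \<in> elems M \<Longrightarrow> integrable (lebesgue_on T) g"
    and "(\<Sum>T\<in>elems M. LINT x|lebesgue_on T. g x) = (LINT x|lebesgue_on \<Omega>. g x)"
proof -
  have fin: "finite (elems M)" and cells: "\<And>T. T \<in> elems M \<Longrightarrow> cell (int DIM('a)) T"
    and cover: "closure \<Omega> = \<Union>(elems M)"
    and disj: "\<And>T T'. T \<in> elems M \<Longrightarrow> T' \<in> elems M \<Longrightarrow> T \<noteq> T' \<Longrightarrow> interior T \<inter> interior T' = {}"
    using part unfolding partition_of_def by auto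
  have closed: "closed T" if "T \<in> elems M" for T
    using cell_compact[OF cells[OF that]] by (rule compact_imp_closed)
  have leb: "T \<in> sets lebesgue" if "T \<in> elems M" for T
    using closed[OF that] by (simp add: borel_closed)
  have "\<Omega> \<in> sets lebesgue"
    using dom unfolding polyhedral_domain_def by (auto simp: borel_open)
  have neg: "negligible (frontier T)" if "T \<in> elems M" for T
    using cell_frontier_negligible[OF cells[OF that]] .
  have bdry: "negligible (closure \<Omega> - \<Omega>)"
  proof (rule negligible_subset)
    show "negligible (\<Union>(frontier ` elems M))"
      using fin neg by (intro negligible_Union) auto
    show "closure \<Omega> - \<Omega> \<subseteq> \<Union>(frontier ` elems M)"
    proof
      fix x assume x: "x \<in> closure \<Omega> - \<Omega>"
      then obtain T where T: "T \<in> elems M" "x \<in> T" using cover by blast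
      have "interior T \<subseteq> \<Omega>"
        using interior_mono[of T "closure \<Omega>"] interior_closure_polyhedral_domain[OF dom] T cover by blast
      then have "x \<in> frontier T"
        using T x closed[OF T(1)] by (auto simp: frontier_def)
      then show "x \<in> \<Union>(frontier ` elems M)" using T by blast
    qed
  qed
  have spike1: "negligible {x \<in> \<Omega> - closure \<Omega>. g x \<noteq> 0}"
    by (rule negligible_subset[OF negligible_empty]) (use closure_subset in auto)
  have spike2: "negligible {x \<in> closure \<Omega> - \<Omega>. g x \<noteq> 0}"
    by (rule negligible_subset[OF bdry]) auto
  have "g absolutely_integrable_on \<Omega>"
    using g \<open>\<Omega> \<in> sets lebesgue\<close> by (simp add: absolutely_integrable_on_iff_integrable_lebesgue_on)
  then have gc: "g absolutely_integrable_on closure \<Omega>"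
    by (rule absolutely_integrable_spike_set[OF _ spike1 spike2])
  have gT: "integrable (lebesgue_on T) g" if "T \<in> elems M" for T
  proof -
    have "g absolutely_integrable_on T"
      using set_integrable_subset[OF gc] leb[OF that] that cover by auto
    then show ?thesis using leb[OF that] by (simp add: absolutely_integrable_on_iff_integrable_lebesgue_on)
  qed
  then show "T \<in> elems M \<Longrightarrow> integrable (lebesgue_on T) g" .
  have "(g has_integral (\<Sum>T\<in>elems M. LINT x|lebesgue_on T. g x)) (\<Union>(elems M))"
  proof (rule has_integral_Union[OF fin])
    show "(g has_integral (LINT x|lebesgue_on T. g x)) T" if "T \<in> elems M" for T
      using has_integral_integral_lebesgue_on[OF gT[OF that] leb[OF that]] .
    show "pairwise (\<lambda>S S'. negligible (S \<inter> S')) (elems M)"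
    proof (rule pairwiseI)
      fix T T' assume T: "T \<in> elems M" "T' \<in> elems M" "T \<noteq> T'"
      have "T \<inter> T' \<subseteq> frontier T \<union> frontier T'"
        using disj[OF T] closed[OF T(1)] closed[OF T(2)] by (auto simp: frontier_def)
      then show "negligible (T \<inter> T')"
        using neg[OF T(1)] neg[OF T(2)] by (meson negligible_Un negligible_subset)
    qed
  qed
  then have "(\<Sum>T\<in>elems M. LINT x|lebesgue_on T. g x) = integral (closure \<Omega>) g"
    unfolding cover by (simp add: integral_unique)
  also have "\<dots> = integral \<Omega> g"
    by (rule integral_spike_set[OF spike2 spike1])
  also have "\<dots> = (LINT x|lebesgue_on \<Omega>. g x)"
    using lebesgue_integral_eq_integral[OF g \<open>\<Omega> \<in> sets lebesgue\<close>] by simp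
  finally show "(\<Sum>T\<in>elems M. LINT x|lebesgue_on T. g x) = (LINT x|lebesgue_on \<Omega>. g x)" .
qed

lemma element_compact:
  fixes M :: "'a::euclidean_space mesh"
  shows "partition_of \<Omega> M \<Longrightarrow> T \<in> elems M \<Longrightarrow> compact T"
  by (rule cell_compact[of "int DIM('a)"]) (simp add: partition_of_def)

section \<open>Point values of functions of time\<close>

lemma polys_continuous: "p \<in> polys k \<Longrightarrow> continuous_on A p"
  unfolding polys_def by (auto intro!: continuous_intros)

lemma face_polys_continuous:
  assumes "p \<in> face_polys k e"
  shows "continuous_on e p"
proof -
  obtain q where q: "q \<in> polys k" "p = (\<lambda>x. if x \<in> e then q x else 0)"
    using assms unfolding face_polys_def by blast
  show ?thesis
    using continuous_on_cong[THEN iffD1, OF refl _ polys_continuous[OF q(1)], of e p] q(2) by simp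
qed

text \<open>
  On compact elements and faces the suprema in \<open>Vh_norm\<close> are finite for these weak functions. The
  resulting bounds are applied to differences of members of \<open>Vh M k\<close>, and closure under differences
  is immediate for continuous components.
\<close>
definition continuous_weak_funs :: "'a::topological_space mesh \<Rightarrow> 'a weak_fun set" where
  "continuous_weak_funs M = {v. (\<forall>T\<in>elems M. continuous_on T (v0 v T)) \<and>
     (\<forall>e\<in>faces M. continuous_on e (vb v e) \<and> continuous_on e (vn v e))}"

lemma Vh_continuous: "v \<in> Vh M k \<Longrightarrow> v \<in> continuous_weak_funs M"
  unfolding Vh_def continuous_weak_funs_def by (blast intro: polys_continuous face_polys_continuous)

lemma Vh0_continuous: "v \<in> Vh0 \<Omega> M k \<Longrightarrow> v \<in> continuous_weak_funs M"
  by (rule Vh_continuous[of v M k]) (simp add: Vh0_def)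

lemma continuous_weak_funs_diff:
  "v \<in> continuous_weak_funs M \<Longrightarrow> w \<in> continuous_weak_funs M \<Longrightarrow> v - w \<in> continuous_weak_funs M"
  for v w :: "'a::topological_space weak_fun"
  by (auto simp: continuous_weak_funs_def fun_diff_def intro!: continuous_on_diff)

lemma abs_le_SUP_compact:
  fixes g :: "'a::topological_space \<Rightarrow> real"
  assumes "compact K" "continuous_on K g" "x \<in> K"
  shows "\<bar>g x\<bar> \<le> (SUP y\<in>K. \<bar>g y\<bar>)"
proof (rule cSUP_upper[OF assms(3)])
  have "compact ((\<lambda>y. \<bar>g y\<bar>) ` K)"
    using assms by (intro compact_continuous_image continuous_intros)
  then show "bdd_above ((\<lambda>y. \<bar>g y\<bar>) ` K)"
    by (intro bounded_imp_bdd_above compact_imp_bounded)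
qed

text \<open>
  Convergence in \<open>Vh_norm\<close> thereby implies convergence of the point values. That the elements and
  faces are nonempty ensures that none of the suprema is negative.
\<close>
lemma abs_interior_le_Vh_norm:
  fixes M :: "'a::euclidean_space mesh"
  assumes part: "partition_of \<Omega> M" and v: "v \<in> continuous_weak_funs M"
    and T: "T \<in> elems M" "x \<in> T"
  shows "\<bar>v0 v T x\<bar> \<le> Vh_norm M v"
proof -
  have fin: "finite (elems M)" "finite (faces M)"
    and cT: "\<And>T. T \<in> elems M \<Longrightarrow> cell (int DIM('a)) T"
    and ce: "\<And>e. e \<in> faces M \<Longrightarrow> cell (int DIM('a) - 1) e"
    using part unfolding partition_of_def by auto
  have SUP0: "0 \<le> (SUP y\<in>K. \<bar>g y\<bar>)" if K: "cell m K" "0 \<le> m" and g: "continuous_on K g"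
    for m K and g :: "'a \<Rightarrow> real"
  proof -
    obtain y where "y \<in> K" using cell_nonempty[OF K] by blast
    then have "\<bar>g y\<bar> \<le> (SUP y\<in>K. \<bar>g y\<bar>)"
      using abs_le_SUP_compact[OF cell_compact[OF K(1)] g] by blast
    then show ?thesis by linarith
  qed
  have dim: "0 \<le> int DIM('a) - 1" using DIM_positive[where 'a = 'a] by linarith
  have "\<bar>v0 v T x\<bar> \<le> (SUP y\<in>T. \<bar>v0 v T y\<bar>)"
    using v T by (intro abs_le_SUP_compact cell_compact[OF cT]) (auto simp: continuous_weak_funs_def)
  also have "\<dots> \<le> (\<Sum>T\<in>elems M. SUP y\<in>T. \<bar>v0 v T y\<bar>)"
    using v by (intro member_le_sum[OF T(1)] fin SUP0[OF cT]) (auto simp: continuous_weak_funs_def)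
  finally have "\<bar>v0 v T x\<bar> \<le> (\<Sum>T\<in>elems M. SUP y\<in>T. \<bar>v0 v T y\<bar>)" .
  moreover have "0 \<le> (\<Sum>e\<in>faces M. SUP y\<in>e. \<bar>vb v e y\<bar>)" "0 \<le> (\<Sum>e\<in>faces M. SUP y\<in>e. \<bar>vn v e y\<bar>)"
    using v by (intro sum_nonneg SUP0[OF ce dim]; simp add: continuous_weak_funs_def)+
  ultimately show ?thesis unfolding Vh_norm_def by linarith
qed

text \<open>
  This uses the completeness of the Lebesgue measure.
\<close>
lemma borel_measurable_AE_limit:
  fixes b :: "'a::euclidean_space \<Rightarrow> real"
  assumes I: "I \<in> sets lebesgue" and g: "\<And>n. g n \<in> borel_measurable (lebesgue_on I)"
    and lim: "AE t in lebesgue_on I. (\<lambda>n. g n t) \<longlonglongrightarrow> b t"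
  shows "b \<in> borel_measurable (lebesgue_on I)"
proof -
  from lim obtain N where N: "N \<in> null_sets (lebesgue_on I)"
    and sub: "{t \<in> space (lebesgue_on I). \<not> (\<lambda>n. g n t) \<longlonglongrightarrow> b t} \<subseteq> N"
    unfolding eventually_ae_filter by blast
  have "b \<in> borel_measurable (lebesgue_on (I - N))"
  proof (rule borel_measurable_LIMSEQ_real)
    show "(\<lambda>n. g n t) \<longlonglongrightarrow> b t" if "t \<in> space (lebesgue_on (I - N))" for t
      using sub that by auto
    show "g n \<in> borel_measurable (lebesgue_on (I - N))" for n
      using measurable_restrict_mono[OF g, of "I - N"] by simp
  qed
  then show ?thesis using borel_measurable_diff_null[OF N I] by blast
qed

text \<open>
  Point values of the approximating simple functions are simple, which gives
  measurability; the bound \<open>y \<le> 1 + y\<^sup>2\<close> turns square integrability on a bounded interval into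
  integrability.
\<close>
lemma bochner_L2_point_value_integrable:
  fixes M :: "(real ^ 'd) mesh"
  assumes part: "partition_of \<Omega> M" and T: "T \<in> elems M" "x \<in> T"
    and g: "bochner_L2 tbar (Vh0 \<Omega> M k) (Vh_norm M) g"
  shows "integrable (lebesgue_on {0..tbar}) (\<lambda>t. v0 (g t) T x)"
proof -
  obtain s where gV: "AE t in lebesgue_on {0..tbar}. g t \<in> Vh0 \<Omega> M k"
    and fin: "\<And>n. finite (s n ` {0..tbar})" and sV: "\<And>n. s n ` {0..tbar} \<subseteq> Vh0 \<Omega> M k"
    and meas: "\<And>n y. {t \<in> {0..tbar}. s n t = y} \<in> sets lebesgue"
    and lim: "AE t in lebesgue_on {0..tbar}. (\<lambda>n. Vh_norm M (s n t - g t)) \<longlonglongrightarrow> 0"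
    and int: "integrable (lebesgue_on {0..tbar}) (\<lambda>t. (Vh_norm M (g t))\<^sup>2)"
    using g unfolding bochner_L2_def by blast
  have "(\<lambda>t. v0 (g t) T x) \<in> borel_measurable (lebesgue_on {0..tbar})"
  proof (rule borel_measurable_AE_limit)
    show "(\<lambda>t. v0 (s n t) T x) \<in> borel_measurable (lebesgue_on {0..tbar})" for n
    proof -
      have "simple_function (lebesgue_on {0..tbar}) (s n)"
        unfolding simple_function_def
      proof (intro conjI ballI)
        show "finite (s n ` space (lebesgue_on {0..tbar}))" using fin by simp
        fix y
        have "s n -` {y} \<inter> {0..tbar} = {t \<in> {0..tbar}. s n t = y}" by auto
        then show "s n -` {y} \<inter> space (lebesgue_on {0..tbar}) \<in> sets (lebesgue_on {0..tbar})"
          using meas[of n y] by (auto simp: sets_restrict_space_iff)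
      qed
      from simple_function_compose[OF this, of "\<lambda>v. v0 v T x"]
      show ?thesis by (intro borel_measurable_simple_function) (simp add: comp_def)
    qed
    have "AE t in lebesgue_on {0..tbar}. t \<in> {0..tbar}"
      using AE_space[of "lebesgue_on {0..tbar}"] by simp
    with gV lim show "AE t in lebesgue_on {0..tbar}. (\<lambda>n. v0 (s n t) T x) \<longlonglongrightarrow> v0 (g t) T x"
    proof eventually_elim
      case (elim t)
      have "\<bar>v0 (s n t) T x - v0 (g t) T x\<bar> \<le> Vh_norm M (s n t - g t)" for n
      proof -
        have "s n t \<in> Vh0 \<Omega> M k" using sV[of n] elim by blast
        then have "s n t - g t \<in> continuous_weak_funs M"
          using elim Vh0_continuous by (intro continuous_weak_funs_diff) blast+
        from abs_interior_le_Vh_norm[OF part this T] show ?thesis by simp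
      qed
      then have "(\<lambda>n. v0 (s n t) T x - v0 (g t) T x) \<longlonglongrightarrow> 0"
        by (intro Lim_null_comparison[OF always_eventually elim(2)]) simp
      then show ?case by (simp add: LIM_zero_iff)
    qed
  qed simp
  then show ?thesis
  proof (rule Bochner_Integration.integrable_bound[rotated])
    show "integrable (lebesgue_on {0..tbar}) (\<lambda>t. 1 + (Vh_norm M (g t))\<^sup>2)"
      by (intro Bochner_Integration.integrable_add int continuous_imp_integrable_real continuous_on_const)
    show "AE t in lebesgue_on {0..tbar}. norm (v0 (g t) T x) \<le> norm (1 + (Vh_norm M (g t))\<^sup>2)"
      using gV
    proof eventually_elim
      case (elim t)
      have "\<bar>v0 (g t) T x\<bar> \<le> Vh_norm M (g t)"
        using abs_interior_le_Vh_norm[OF part Vh0_continuous[OF elim] T] .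
      also have "\<dots> \<le> 1 + (Vh_norm M (g t))\<^sup>2"
        using zero_le_power2[of "Vh_norm M (g t) - 1 / 2"] by (simp add: power2_eq_square algebra_simps)
      finally show ?case by simp
    qed
  qed
qed

lemma H1_time_point_value_continuous:
  fixes M :: "(real ^ 'd) mesh"
  assumes part: "partition_of \<Omega> M" and T: "T \<in> elems M" "x \<in> T"
    and u: "H1_time tbar \<Omega> M k u u'"
  shows "continuous_on {0..tbar} (\<lambda>t. v0 (u t) T x)"
  unfolding continuous_on_def
proof
  fix t assume t: "t \<in> {0..tbar}"
  have uV: "u t \<in> continuous_weak_funs M" if "t \<in> {0..tbar}" for t
    using u that unfolding H1_time_def by (intro Vh0_continuous) blast
  have lim: "((\<lambda>s. Vh_norm M (u s - u t)) \<longlongrightarrow> 0) (at t within {0..tbar})"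
    using u t by (simp add: H1_time_def)
  have "\<forall>\<^sub>F s in at t within {0..tbar}. norm (v0 (u s) T x - v0 (u t) T x) \<le> Vh_norm M (u s - u t)"
    unfolding eventually_at_filter
  proof (intro always_eventually allI impI)
    fix s assume "s \<in> {0..tbar}"
    then have "u s - u t \<in> continuous_weak_funs M" using t by (intro continuous_weak_funs_diff uV)
    from abs_interior_le_Vh_norm[OF part this T]
    show "norm (v0 (u s) T x - v0 (u t) T x) \<le> Vh_norm M (u s - u t)" by simp
  qed
  from Lim_null_comparison[OF this lim]
  show "((\<lambda>s. v0 (u s) T x) \<longlongrightarrow> v0 (u t) T x) (at t within {0..tbar})"
    by (simp add: LIM_zero_iff)
qed

section \<open>The elementwise inner product\<close>

lemma ip_commute: "ip M p q = ip M q p"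
  by (simp add: ip_def mult.commute)

lemma ip_self_nonneg: "0 \<le> ip M p p"
  unfolding ip_def by (intro sum_nonneg Bochner_Integration.integral_nonneg) simp

lemma wf_norm_squared: "(wf_norm M v)\<^sup>2 = ip M (v0 v) (v0 v)"
  by (simp add: wf_norm_def ip_self_nonneg)

lemma ip_point_values:
  fixes M :: "(real ^ 'd) mesh"
  assumes part: "partition_of \<Omega> M"
  shows "\<exists>S G. (\<forall>T\<in>elems M. finite (S T) \<and> S T \<subseteq> T) \<and> (\<forall>v\<in>Vh M k. \<forall>w\<in>Vh M k.
    ip M (v0 v) (v0 w) = (\<Sum>T\<in>elems M. \<Sum>y\<in>S T. \<Sum>z\<in>S T. G T y z * (v0 v T y * v0 w T z)))"
proof -
  have "\<forall>T\<in>elems M. \<exists>S G. finite S \<and> S \<subseteq> T \<and> (\<forall>p\<in>polys k. \<forall>q\<in>polys k.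
    (LINT x|lebesgue_on T. p x * q x) = (\<Sum>y\<in>S. \<Sum>z\<in>S. G y z * (p y * q z)))"
    by (intro ballI polys_inner_product_point_values element_compact[OF part])
  then obtain S G where SG: "\<forall>T\<in>elems M. finite (S T) \<and> S T \<subseteq> T \<and> (\<forall>p\<in>polys k. \<forall>q\<in>polys k.
    (LINT x|lebesgue_on T. p x * q x) = (\<Sum>y\<in>S T. \<Sum>z\<in>S T. G T y z * (p y * q z)))"
    unfolding bchoice_iff by (elim exE)
  show ?thesis
  proof (intro exI[of _ S] exI[of _ G] conjI ballI)
    fix v w assume "v \<in> Vh M k" "w \<in> Vh M k"
    then have "\<And>T. T \<in> elems M \<Longrightarrow> v0 v T \<in> polys k" "\<And>T. T \<in> elems M \<Longrightarrow> v0 w T \<in> polys k"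
      by (simp_all add: Vh_def)
    with SG show "ip M (v0 v) (v0 w) = (\<Sum>T\<in>elems M. \<Sum>y\<in>S T. \<Sum>z\<in>S T. G T y z * (v0 v T y * v0 w T z))"
      unfolding ip_def by (intro sum.cong refl) blast
  qed (use SG in blast)+
qed

text \<open>
  Young's inequality on every element; a large weight \<open>c\<close> makes the last term small enough to be
  absorbed into the energy.
\<close>
lemma ip_Young:
  fixes M :: "(real ^ 'd) mesh"
  assumes dom: "polyhedral_domain \<Omega>" and part: "partition_of \<Omega> M"
    and g: "integrable (lebesgue_on \<Omega>) (\<lambda>x. (g x)\<^sup>2)" and v: "v \<in> Vh M k" and "0 < c"
  shows "2 * ip M (\<lambda>T. g) (v0 v) \<le> c * (LINT x|lebesgue_on \<Omega>. (g x)\<^sup>2) + ip M (v0 v) (v0 v) / c"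
proof -
  have gT: "integrable (lebesgue_on T) (\<lambda>x. (g x)\<^sup>2)" if "T \<in> elems M" for T
    by (rule sum_integral_elements(1)[OF dom part g that])
  have vT: "integrable (lebesgue_on T) (\<lambda>x. v0 v T x * v0 v T x)" if "T \<in> elems M" for T
    using v that
    by (intro integrable_continuous_on_compact element_compact[OF part] continuous_on_mult polys_continuous[of _ k])
      (simp_all add: Vh_def)
  have "(LINT x|lebesgue_on T. g x * v0 v T x) \<le>
      c / 2 * (LINT x|lebesgue_on T. (g x)\<^sup>2) + (LINT x|lebesgue_on T. v0 v T x * v0 v T x) / (2 * c)"
    if T: "T \<in> elems M" for T
  proof -
    have "(LINT x|lebesgue_on T. g x * v0 v T x) \<le>
        (LINT x|lebesgue_on T. c / 2 * (g x)\<^sup>2 + (v0 v T x * v0 v T x) / (2 * c))"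
    proof (rule integral_mono')
      show "integrable (lebesgue_on T) (\<lambda>x. c / 2 * (g x)\<^sup>2 + (v0 v T x * v0 v T x) / (2 * c))"
        using gT[OF T] vT[OF T] by simp
      fix x
      show "0 \<le> c / 2 * (g x)\<^sup>2 + (v0 v T x * v0 v T x) / (2 * c)" using \<open>0 < c\<close> by simp
      have "0 \<le> (c * g x - v0 v T x)\<^sup>2 / (2 * c)" using \<open>0 < c\<close> by simp
      also have "\<dots> = c / 2 * (g x)\<^sup>2 + (v0 v T x * v0 v T x) / (2 * c) - g x * v0 v T x"
        using \<open>0 < c\<close> by (simp add: power2_eq_square field_simps)
      finally show "g x * v0 v T x \<le> c / 2 * (g x)\<^sup>2 + (v0 v T x * v0 v T x) / (2 * c)" by simp
    qed
    then show ?thesis using gT[OF T] vT[OF T] by simp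
  qed
  then have "ip M (\<lambda>T. g) (v0 v) \<le> (\<Sum>T\<in>elems M. c / 2 * (LINT x|lebesgue_on T. (g x)\<^sup>2) +
      (LINT x|lebesgue_on T. v0 v T x * v0 v T x) / (2 * c))"
    unfolding ip_def by (rule sum_mono)
  also have "\<dots> = c / 2 * (\<Sum>T\<in>elems M. LINT x|lebesgue_on T. (g x)\<^sup>2) + ip M (v0 v) (v0 v) / (2 * c)"
    by (simp add: sum.distrib sum_distrib_left sum_divide_distrib ip_def)
  finally show ?thesis
    unfolding sum_integral_elements(2)[OF dom part g] by simp
qed

section \<open>The energy estimate\<close>

text \<open>
  The function \<open>h\<close> is the expression for \<open>2 (u_t, u)\<close> in terms of point values. It is measurable by
  construction, and it agrees with the inner product at the times at which \<open>u'\<close> takes its value in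
  \<open>Vh M k\<close>.
\<close>
lemma energy_identity:
  fixes M :: "(real ^ 'd) mesh"
  assumes part: "partition_of \<Omega> M" and u: "H1_time tbar \<Omega> M k u u'"
  shows "\<exists>h. integrable (lebesgue_on {0..tbar}) h \<and>
    (AE s in lebesgue_on {0..tbar}. h s = 2 * ip M (v0 (u' s)) (v0 (u s))) \<and>
    (\<forall>t\<in>{0..tbar}. ip M (v0 (u t)) (v0 (u t)) - ip M (v0 (u 0)) (v0 (u 0)) = (LINT s|lebesgue_on {0..t}. h s))"
proof -
  obtain S G where SG: "(\<forall>T\<in>elems M. finite (S T) \<and> S T \<subseteq> T) \<and> (\<forall>v\<in>Vh M k. \<forall>w\<in>Vh M k.
    ip M (v0 v) (v0 w) = (\<Sum>T\<in>elems M. \<Sum>y\<in>S T. \<Sum>z\<in>S T. G T y z * (v0 v T y * v0 w T z)))"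
    using ip_point_values[OF part, of k] by (elim exE)
  then have ST: "y \<in> T" if "T \<in> elems M" "y \<in> S T" for T y using that by blast
  have ip_eq: "ip M (v0 v) (v0 w) = (\<Sum>T\<in>elems M. \<Sum>y\<in>S T. \<Sum>z\<in>S T. G T y z * (v0 v T y * v0 w T z))"
    if "v \<in> Vh M k" "w \<in> Vh M k" for v w
    using SG that by blast
  have uV: "u t \<in> Vh M k" if "t \<in> {0..tbar}" for t
    using u that by (simp add: H1_time_def Vh0_def)
  have u'V: "AE s in lebesgue_on {0..tbar}. u' s \<in> Vh M k"
    using u unfolding H1_time_def bochner_L2_def Vh0_def by (auto elim: eventually_mono)
  have u'int: "integrable (lebesgue_on {0..tbar}) (\<lambda>s. v0 (u' s) T y)" if "T \<in> elems M" "y \<in> T" for T y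
    using u unfolding H1_time_def by (intro bochner_L2_point_value_integrable[OF part that]) blast
  have ucont: "continuous_on {0..tbar} (\<lambda>s. v0 (u s) T y)" if "T \<in> elems M" "y \<in> T" for T y
    by (rule H1_time_point_value_continuous[OF part that u])
  have uint: "v0 (u t) T y - v0 (u s) T y = (LINT r|lebesgue_on {s..t}. v0 (u' r) T y)"
    if T: "T \<in> elems M" "y \<in> T" and st: "0 \<le> s" "s \<le> t" "t \<le> tbar" for T y s t
  proof (rule weak_derivative_imp_integral[OF ucont[OF T] u'int[OF T] _ st])
    fix \<phi> assume "\<phi> \<in> test_functions {0<..<tbar}"
    then show "(LINT t|lebesgue_on {0..tbar}. v0 (u t) T y * deriv \<phi> t) =
        - (LINT t|lebesgue_on {0..tbar}. v0 (u' t) T y * \<phi> t)"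
      using u T unfolding H1_time_def weak_time_deriv_def by blast
  qed
  define g where "g T y z s = v0 (u' s) T y * v0 (u s) T z + v0 (u' s) T z * v0 (u s) T y" for T y z s
  define h where "h s = (\<Sum>T\<in>elems M. \<Sum>y\<in>S T. \<Sum>z\<in>S T. G T y z * g T y z s)" for s
  have gint: "integrable (lebesgue_on {0..tbar}) (g T y z)" if T: "T \<in> elems M" and "y \<in> S T" "z \<in> S T" for T y z
    unfolding g_def[abs_def] using ST[OF T] that(2,3)
    by (intro Bochner_Integration.integrable_add integrable_mult_continuous u'int[OF T] ucont[OF T]) simp_all
  have hint: "integrable (lebesgue_on {0..tbar}) h"
    unfolding h_def[abs_def]
    by (intro Bochner_Integration.integrable_sum integrable_mult_right gint)
  have "AE s in lebesgue_on {0..tbar}. s \<in> {0..tbar}"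
    using AE_space[of "lebesgue_on {0..tbar}"] by simp
  with u'V have "AE s in lebesgue_on {0..tbar}. h s = 2 * ip M (v0 (u' s)) (v0 (u s))"
  proof eventually_elim
    case (elim s)
    have "h s = (\<Sum>T\<in>elems M. \<Sum>y\<in>S T. \<Sum>z\<in>S T.
        G T y z * (v0 (u' s) T y * v0 (u s) T z) + G T y z * (v0 (u s) T y * v0 (u' s) T z))"
      unfolding h_def g_def by (intro sum.cong refl) (simp add: algebra_simps)
    also have "\<dots> = ip M (v0 (u' s)) (v0 (u s)) + ip M (v0 (u s)) (v0 (u' s))"
      unfolding ip_eq[OF elim(1) uV[OF elim(2)]] ip_eq[OF uV[OF elim(2)] elim(1)] sum.distrib ..
    also have "ip M (v0 (u s)) (v0 (u' s)) = ip M (v0 (u' s)) (v0 (u s))" by (rule ip_commute)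
    finally show ?case by simp
  qed
  moreover have "ip M (v0 (u t)) (v0 (u t)) - ip M (v0 (u 0)) (v0 (u 0)) = (LINT s|lebesgue_on {0..t}. h s)"
    if t: "t \<in> {0..tbar}" for t
  proof -
    have t0: "0 \<in> {0..tbar}" using t by simp
    have gint': "integrable (lebesgue_on {0..t}) (g T y z)" if "T \<in> elems M" "y \<in> S T" "z \<in> S T" for T y z
      by (rule integrable_subinterval[OF gint[OF that]]) (use t in auto)
    have "ip M (v0 (u t)) (v0 (u t)) - ip M (v0 (u 0)) (v0 (u 0)) =
        (\<Sum>T\<in>elems M. \<Sum>y\<in>S T. \<Sum>z\<in>S T.
          G T y z * (v0 (u t) T y * v0 (u t) T z - v0 (u 0) T y * v0 (u 0) T z))"
      unfolding ip_eq[OF uV[OF t] uV[OF t]] ip_eq[OF uV[OF t0] uV[OF t0]]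
      by (simp only: sum_subtractf right_diff_distrib)
    also have "\<dots> = (\<Sum>T\<in>elems M. \<Sum>y\<in>S T. \<Sum>z\<in>S T. G T y z * (LINT s|lebesgue_on {0..t}. g T y z s))"
    proof (intro sum.cong refl arg_cong2[where f = "(*)"])
      fix T y z assume T: "T \<in> elems M" and yz: "y \<in> S T" "z \<in> S T"
      note y = ST[OF T yz(1)] and z = ST[OF T yz(2)]
      show "v0 (u t) T y * v0 (u t) T z - v0 (u 0) T y * v0 (u 0) T z = (LINT s|lebesgue_on {0..t}. g T y z s)"
        unfolding g_def
        by (rule integral_product_rule[OF u'int[OF T y] u'int[OF T z] ucont[OF T y] ucont[OF T z]
              uint[OF T y] uint[OF T z]]) (use t in auto)
    qed
    also have "\<dots> = (\<Sum>T\<in>elems M. \<Sum>y\<in>S T. \<Sum>z\<in>S T. LINT s|lebesgue_on {0..t}. G T y z * g T y z s)"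
      by simp
    also have "\<dots> = (\<Sum>T\<in>elems M. \<Sum>y\<in>S T. LINT s|lebesgue_on {0..t}. (\<Sum>z\<in>S T. G T y z * g T y z s))"
      by (intro sum.cong refl Bochner_Integration.integral_sum[symmetric] integrable_mult_right gint')
    also have "\<dots> = (\<Sum>T\<in>elems M. LINT s|lebesgue_on {0..t}. (\<Sum>y\<in>S T. \<Sum>z\<in>S T. G T y z * g T y z s))"
      by (intro sum.cong refl Bochner_Integration.integral_sum[symmetric]
          Bochner_Integration.integrable_sum integrable_mult_right gint')
    also have "\<dots> = (LINT s|lebesgue_on {0..t}. h s)"
      unfolding h_def
      by (intro Bochner_Integration.integral_sum[symmetric]
          Bochner_Integration.integrable_sum integrable_mult_right gint')
    finally show ?thesis .
  qed
  ultimately show ?thesis using hint by blast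
qed

text \<open>
  An alternative to Gronwall's lemma that gives a bound linear in \<open>T\<close>. At the point \<open>r\<close> of \<open>{0..t}\<close>
  where \<open>E\<close> is maximal, the integral of \<open>E s / (2 * T)\<close> up to \<open>r\<close> is at most \<open>E r / 2\<close>.
\<close>
lemma linear_growth_bound:
  fixes E h G :: "real \<Rightarrow> real"
  assumes "0 < T" and h: "integrable (lebesgue_on {0..T}) h" and G: "integrable (lebesgue_on {0..T}) G"
    and E: "\<And>t. t \<in> {0..T} \<Longrightarrow> E t - E 0 = (LINT s|lebesgue_on {0..t}. h s)"
    and E0: "\<And>t. 0 \<le> E t" and G0: "\<And>t. 0 \<le> G t"
    and hG: "AE s in lebesgue_on {0..T}. h s \<le> 2 * T * G s + E s / (2 * T)"
    and t: "t \<in> {0..T}"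
  shows "E t \<le> 2 * E 0 + 4 * T * (LINT s|lebesgue_on {0..t}. G s)"
proof -
  have "continuous_on {0..T} (\<lambda>t. E 0 + (LINT s|lebesgue_on {0..t}. h s))"
    by (intro continuous_intros indefinite_integral_continuous_real h)
  moreover have "E 0 + (LINT s|lebesgue_on {0..t}. h s) = E t" if "t \<in> {0..T}" for t
    using E[OF that] by simp
  ultimately have "continuous_on {0..T} E"
    by (rule continuous_on_eq)
  then have "continuous_on {0..t} E"
    by (rule continuous_on_subset) (use t in auto)
  then obtain r where r: "r \<in> {0..t}" and max: "\<And>s. s \<in> {0..t} \<Longrightarrow> E s \<le> E r"
    using continuous_attains_sup[of "{0..t}" E] t by auto
  have sub: "{0..r} \<subseteq> {0..T}" using r t by auto
  have "E r - E 0 = (LINT s|lebesgue_on {0..r}. h s)"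
    using r t by (intro E) auto
  also have "\<dots> \<le> (LINT s|lebesgue_on {0..r}. 2 * T * G s + E r / (2 * T))"
  proof (rule integral_mono_AE)
    show "integrable (lebesgue_on {0..r}) h"
      by (rule integrable_subinterval[OF h sub])
    show "integrable (lebesgue_on {0..r}) (\<lambda>s. 2 * T * G s + E r / (2 * T))"
      by (intro Bochner_Integration.integrable_add integrable_mult_right integrable_subinterval[OF G sub]
          continuous_imp_integrable_real continuous_on_const)
    have "AE s in lebesgue_on {0..r}. h s \<le> 2 * T * G s + E s / (2 * T)"
      using hG sub by (auto simp: AE_restrict_space_iff elim!: eventually_mono)
    then show "AE s in lebesgue_on {0..r}. h s \<le> 2 * T * G s + E r / (2 * T)"
    proof (rule lebesgue_on_mono)
      fix s assume s: "h s \<le> 2 * T * G s + E s / (2 * T)" "s \<in> {0..r}"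
      have "E s \<le> E r" using max[of s] s r by auto
      then have "E s / (2 * T) \<le> E r / (2 * T)" using \<open>0 < T\<close> by (intro divide_right_mono) auto
      then show "h s \<le> 2 * T * G s + E r / (2 * T)" using s by linarith
    qed
  qed
  also have "\<dots> = 2 * T * (LINT s|lebesgue_on {0..r}. G s) + r * (E r / (2 * T))"
  proof -
    have "integrable (lebesgue_on {0..r}) (\<lambda>s. E r / (2 * T))"
      by (intro continuous_imp_integrable_real continuous_on_const)
    then show ?thesis
      using integrable_subinterval[OF G sub] r by (simp add: measure_restrict_space)
  qed
  also have "\<dots> \<le> 2 * T * (LINT s|lebesgue_on {0..t}. G s) + E r / 2"
  proof (rule add_mono)
    have "(LINT s|lebesgue_on {0..r}. G s) \<le> (LINT s|lebesgue_on {0..t}. G s)"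
      using r t G0 by (intro integral_mono_lebesgue_on_AE integrable_subinterval[OF G]) auto
    then show "2 * T * (LINT s|lebesgue_on {0..r}. G s) \<le> 2 * T * (LINT s|lebesgue_on {0..t}. G s)"
      using \<open>0 < T\<close> by simp
    have "r * (E r / (2 * T)) \<le> T * (E r / (2 * T))"
      using r t E0[of r] \<open>0 < T\<close> by (intro mult_right_mono) auto
    then show "r * (E r / (2 * T)) \<le> E r / 2" using \<open>0 < T\<close> by simp
  qed
  finally have "E r \<le> 2 * E 0 + 4 * T * (LINT s|lebesgue_on {0..t}. G s)" by simp
  then show ?thesis using max[of t] t by simp
qed

theorem theorem3p6:
  fixes \<Omega> :: "(real ^ 'd) set" and tbar :: real and k r N :: nat
    and \<rho>v \<rho>e \<kappa> \<sigma> \<gamma> \<rho>s :: real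
    and \<M> :: "(real ^ 'd) mesh set"
  assumes "CARD('d) = 2 \<or> CARD('d) = 3"
    and "polyhedral_domain \<Omega>"
    and "0 < tbar"
    and "2 \<le> k"
    and "0 < \<rho>v" "0 < \<rho>e" "0 < \<kappa>" "0 < \<sigma>" "0 < \<gamma>" "0 < \<rho>s"
    and "\<forall>M\<in>\<M>. partition_of \<Omega> M \<and> shape_regular \<rho>v \<rho>e \<kappa> \<sigma> \<gamma> \<rho>s N M"
    and "\<exists>C1>0. \<exists>C2>0. \<forall>M\<in>\<M>. \<forall>v\<in>Vh M k.
           C1 * norm_2h M v \<le> triple_norm r M v \<and> triple_norm r M v \<le> C2 * norm_2h M v"
  shows "\<exists>C>0. \<forall>M\<in>\<M>. \<forall>\<psi> f u.
           \<psi> \<in> H02 \<Omega> \<longrightarrow>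
           bochner_L2 tbar (L2 (lebesgue_on \<Omega>)) (L2_norm (lebesgue_on \<Omega>)) f \<longrightarrow>
           semidiscrete_solution tbar \<Omega> M k r f \<psi> u \<longrightarrow>
           (\<forall>t\<in>{0..tbar}. (wf_norm M (u t))\<^sup>2 \<le>
              C * ((wf_norm M (u 0))\<^sup>2 +
                   (LINT s|lebesgue_on {0..t}. (L2_norm (lebesgue_on \<Omega>) (f s))\<^sup>2)))"
proof (intro exI[of _ "2 + 4 * tbar"] conjI ballI allI impI)
  show "0 < 2 + 4 * tbar" using \<open>0 < tbar\<close> by simp
  fix M \<psi> f u t
  assume "M \<in> \<M>" and f: "bochner_L2 tbar (L2 (lebesgue_on \<Omega>)) (L2_norm (lebesgue_on \<Omega>)) f"
    and sol: "semidiscrete_solution tbar \<Omega> M k r f \<psi> u" and t: "t \<in> {0..tbar}"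
  then have part: "partition_of \<Omega> M" using assms by blast
  obtain u' where u: "H1_time tbar \<Omega> M k u u'"
    and eqn: "AE t in lebesgue_on {0..tbar}. \<forall>v\<in>Vh0 \<Omega> M k.
           ip M (v0 (u' t)) (v0 v) + ip M (weak_laplacian r M (u t)) (weak_laplacian r M v)
           = ip M (\<lambda>T. f t) (v0 v)"
    using sol unfolding semidiscrete_solution_def by blast
  define E where "E s = (wf_norm M (u s))\<^sup>2" for s
  define G where "G s = (L2_norm (lebesgue_on \<Omega>) (f s))\<^sup>2" for s
  have E_ip: "E s = ip M (v0 (u s)) (v0 (u s))" for s by (simp add: E_def wf_norm_squared)
  have G_int: "G s = (LINT x|lebesgue_on \<Omega>. (f s x)\<^sup>2)" for s
    by (simp add: G_def L2_norm_def)
  obtain h where h: "integrable (lebesgue_on {0..tbar}) h"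
    and h_ip: "AE s in lebesgue_on {0..tbar}. h s = 2 * ip M (v0 (u' s)) (v0 (u s))"
    and hE: "\<forall>t\<in>{0..tbar}. E t - E 0 = (LINT s|lebesgue_on {0..t}. h s)"
    using energy_identity[OF part u] unfolding E_ip by blast
  have G: "integrable (lebesgue_on {0..tbar}) G"
    using f by (simp add: bochner_L2_def G_def[abs_def])
  have fL2: "AE s in lebesgue_on {0..tbar}. f s \<in> L2 (lebesgue_on \<Omega>)"
    using f by (simp add: bochner_L2_def)
  have "AE s in lebesgue_on {0..tbar}. s \<in> {0..tbar}"
    using AE_space[of "lebesgue_on {0..tbar}"] by simp
  with eqn h_ip fL2 have hG: "AE s in lebesgue_on {0..tbar}. h s \<le> 2 * tbar * G s + E s / (2 * tbar)"
  proof eventually_elim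
    case (elim s)
    have us: "u s \<in> Vh0 \<Omega> M k" using u elim by (simp add: H1_time_def)
    then have "ip M (v0 (u' s)) (v0 (u s)) + ip M (weak_laplacian r M (u s)) (weak_laplacian r M (u s))
        = ip M (\<lambda>T. f s) (v0 (u s))"
      using elim by blast
    then have "h s \<le> 2 * ip M (\<lambda>T. f s) (v0 (u s))"
      using ip_self_nonneg[of M "weak_laplacian r M (u s)"] elim by linarith
    also have "\<dots> \<le> 2 * tbar * G s + E s / (2 * tbar)"
      unfolding G_int E_ip using elim us \<open>0 < tbar\<close>
      by (intro ip_Young[where k = k] part assms) (auto simp: L2_def Vh0_def)
    finally show ?case .
  qed
  have "E t \<le> 2 * E 0 + 4 * tbar * (LINT s|lebesgue_on {0..t}. G s)"
    by (rule linear_growth_bound[OF \<open>0 < tbar\<close> h G _ _ _ hG t]) (use hE in \<open>auto simp: E_def G_def\<close>)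
  also have "\<dots> \<le> (2 + 4 * tbar) * (E 0 + (LINT s|lebesgue_on {0..t}. G s))"
  proof -
    have "0 \<le> (LINT s|lebesgue_on {0..t}. G s)"
      by (intro Bochner_Integration.integral_nonneg) (simp add: G_def)
    moreover have "0 \<le> E 0" by (simp add: E_def)
    ultimately show ?thesis using \<open>0 < tbar\<close> by (simp add: algebra_simps)
  qed
  finally show "(wf_norm M (u t))\<^sup>2 \<le> (2 + 4 * tbar) * ((wf_norm M (u 0))\<^sup>2 +
      (LINT s|lebesgue_on {0..t}. (L2_norm (lebesgue_on \<Omega>) (f s))\<^sup>2))"
    by (simp add: E_def G_def)
qed

end
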